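(* Let $a,b,c\ge 0$ be real numbers with $a+b+c=1$ and $a<1$, $b<1$, $c<1$. For each odd positive integer $p$, let $X_n$ be the random process on the integers mod $p$ given by $X_0=0$ and $X_{n+1}=2X_n+b_n \pmod p$, where $b_0,b_1,b_2,\dots$ are i.i.d. with $\Pr(b_n=1)=a$, $\Pr(b_n=0)=b$, $\Pr(b_n=-1)=c$. Let $P_n(s)=\Pr(X_n=s)$ for $s\in\mathbb{Z}/p\mathbb{Z}$ (so $P_n$ depends on $p$), and let $U$ be the uniform distribution on $\mathbb{Z}/p\mathbb{Z}$. Case 1: Suppose that either ($b=0$ and $a=c=1/2$) or $b=1/2$. Then for every constant $c_1>1$, if $n>c_1\log_2 p$, then $\|P_n-U\|\to 0$ as $p\to\infty$ through odd integers; that is, for every $\varepsilon>0$ there is $p_0$ such that for all odd $p\ge p_0$ and all integers $n>c_1\log_2 p$ one has $\|P_n-U\|<\varepsilon$. Case 2: Suppose that $a,b,c$ do not satisfy the conditions of Case 1, i.e. $b\neq 1/2$ and it is not the case that both $b=0$ and $a=c=1/2$. Then there exists a constant $c_2>0$ (depending on $a,b,c$) such that if $p=2^t-1$ and $n<c_2(\log p)\log(\log p)$, then $\|P_n-U\|\to 1$ as $t\to\infty$; that is, for every $\varepsilon>0$ there is $t_0$ such that for all integers $t\ge t_0$, with $p=2^t-1$, and all integers $n$ with $0\le n<c_2(\log p)\log(\log p)$, one has $\|P_n-U\|>1-\varepsilon$.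
   Context: For a probability $P$ on a finite group $G$, the variation distance from the uniform distribution $U$ on $G$ is $\|P-U\|=\frac12\sum_{s\in G}\left|P(s)-1/|G|\right|=\max_{A\subseteq G}|P(A)-U(A)|$. Here $\log$ denotes the natural logarithm and $\log_2$ the logarithm to base $2$. *)

theory Defs
  imports "HOL-Probability.Probability"
begin

text \<open>The i.i.d. increments. As \<open>a + b + c = 1\<close> in the intended use, the three probabilities
  determine the common law of the variables \<open>B n\<close>.\<close>

locale iid_increments = prob_space M
  for M :: "'w measure" and B :: "nat \<Rightarrow> 'w \<Rightarrow> int" and a b c :: real +
  assumes indep: "indep_vars (\<lambda>_. count_space UNIV) B UNIV"
    and prob_one: "\<And>n. \<P>(\<omega> in M. B n \<omega> = 1) = a"
    and prob_zero: "\<And>n. \<P>(\<omega> in M. B n \<omega> = 0) = b"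
    and prob_minus_one: "\<And>n. \<P>(\<omega> in M. B n \<omega> = - 1) = c"

text \<open>The integers mod \<open>p\<close> are represented by the residues \<open>{0..<int p}\<close>.\<close>

primrec walk :: "nat \<Rightarrow> (nat \<Rightarrow> 'w \<Rightarrow> int) \<Rightarrow> nat \<Rightarrow> 'w \<Rightarrow> int" where
  "walk p B 0 \<omega> = 0"
| "walk p B (Suc n) \<omega> = (2 * walk p B n \<omega> + B n \<omega>) mod int p"

definition walk_prob :: "'w measure \<Rightarrow> nat \<Rightarrow> (nat \<Rightarrow> 'w \<Rightarrow> int) \<Rightarrow> nat \<Rightarrow> int \<Rightarrow> real" where
  "walk_prob M p B n s = \<P>(\<omega> in M. walk p B n \<omega> = s)"

text \<open>Variation distance from the uniform distribution on the finite set \<open>G\<close> of the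
  probability on \<open>G\<close> with point masses \<open>P\<close>.\<close>

definition unif_dist :: "'a set \<Rightarrow> ('a \<Rightarrow> real) \<Rightarrow> real" where
  "unif_dist G P = 1 / 2 * (\<Sum>s\<in>G. \<bar>P s - 1 / real (card G)\<bar>)"

end

theory Submission
  imports Defs "HOL-Real_Asymp.Real_Asymp"
begin

text \<open>
  In Case 1 the walk is, up to an independent shift and multiplication by a unit mod \<open>p\<close>, uniform
  on \<open>{0..<2 ^ n}\<close>, so every point mass differs from \<open>1 / p\<close> by at most \<open>1 / 2 ^ n\<close>.

  In Case 2 let \<open>p = 2 ^ t - 1\<close> and \<open>\<chi> j s = e(2 ^ j s / p)\<close> for \<open>j < t\<close>. Doubling permutes these
  characters, so each \<open>E (\<chi> j)\<close> is a product running periodically through the same \<open>t\<close> factors,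
  and the product over one period is bounded below by a constant \<open>\<kappa>\<close> because no factor tends
  to zero. For \<open>n \<le> r t\<close> this gives \<open>|E (\<chi> j)| \<ge> \<kappa> ^ r\<close>. Choosing unimodular \<open>\<alpha> j\<close> that cancel
  the phases, \<open>f = (\<Sum>j<t. \<alpha> j \<chi> j)\<close> has mean at least \<open>t \<kappa> ^ r\<close> under the walk and mean zero
  under the uniform distribution. Its variance is \<open>t\<close> under the latter and \<open>O(n)\<close> under the former:
  for most pairs \<open>j, k\<close>, at each time one of the two arguments \<open>2 ^ (i + j) / p\<close>, \<open>2 ^ (i + k) / p\<close>
  is close to an integer, which makes \<open>\<chi> j\<close> and \<open>\<chi> k\<close> almost uncorrelated. By a Chebyshev
  argument the two distributions separate as long as \<open>r\<close> is a small multiple of \<open>ln t\<close>.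
\<close>

section \<open>One step of the walk\<close>

lemma walk_cong:
  "(\<And>i. i < n \<Longrightarrow> B i \<omega> = B' i \<omega>') \<Longrightarrow> walk p B n \<omega> = walk p B' n \<omega>'"
  by (induction n) auto

lemma walk_measurable:
  assumes "\<And>i. i < n \<Longrightarrow> B i \<in> measurable M (count_space UNIV)"
  shows "walk p B n \<in> measurable M (count_space UNIV)"
  using assms
proof (induction n)
  case 0
  then show ?case by simp
next
  case (Suc n)
  have [measurable]: "walk p B n \<in> measurable M (count_space UNIV)"
    "B n \<in> measurable M (count_space UNIV)"
    using Suc by auto
  have "(\<lambda>\<omega>. (2 * walk p B n \<omega> + B n \<omega>) mod int p) \<in> measurable M (count_space UNIV)"
    by measurable
  then show ?case by (simp add: walk.simps[abs_def])
qed

lemma walk_range: "p > 0 \<Longrightarrow> walk p B n \<omega> \<in> {0..<int p}"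
  by (cases n) auto

lemma sum_mod_eq_shift:
  fixes p :: nat
  assumes "p > 0"
  shows "(\<Sum>s\<in>{0..<int p}. of_bool (x mod int p = s) *\<^sub>R g s) = (g (x mod int p) :: 'a::real_vector)"
proof -
  have "(\<Sum>s\<in>{0..<int p}. of_bool (x mod int p = s) *\<^sub>R g s)
      = (\<Sum>s\<in>{0..<int p}. if x mod int p = s then g s else 0)"
    by (intro sum.cong) auto
  also have "\<dots> = g (x mod int p)"
    using assms by (subst sum.delta') auto
  finally show ?thesis .
qed

context iid_increments
begin

lemma B_measurable [measurable]: "B i \<in> measurable M (count_space UNIV)"
  using indep unfolding indep_vars_def by auto

lemma walk_measurable' [measurable]: "walk p B n \<in> measurable M (count_space UNIV)"
  by (rule walk_measurable) simp

text \<open>The walk at time \<open>n\<close> factors through the restriction of the increments to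
  \<open>{..<n}\<close>, which is independent of their restriction to \<open>{n}\<close>.\<close>

lemma prob_walk_increment:
  "\<P>(\<omega> in M. walk p B n \<omega> = r \<and> B n \<omega> = \<beta>)
     = walk_prob M p B n r * \<P>(\<omega> in M. B n \<omega> = \<beta>)"
proof -
  let ?N = "\<lambda>A. PiM A (\<lambda>_::nat. count_space (UNIV :: int set))"
  let ?F = "walk p (\<lambda>i f. f i) n"
  have "?F \<in> measurable (?N {..<n}) (count_space UNIV)"
    by (rule walk_measurable) (auto intro: measurable_component_singleton)
  moreover have "(\<lambda>f. f n) \<in> measurable (?N {n}) (count_space UNIV)"
    by (rule measurable_component_singleton) simp
  moreover have "indep_var (?N {..<n}) (\<lambda>\<omega>. restrict (\<lambda>i. B i \<omega>) {..<n})
      (?N {n}) (\<lambda>\<omega>. restrict (\<lambda>i. B i \<omega>) {n})"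
    by (rule indep_var_restrict[OF indep]) auto
  ultimately have "indep_var (count_space UNIV) (?F \<circ> (\<lambda>\<omega>. restrict (\<lambda>i. B i \<omega>) {..<n}))
      (count_space UNIV) ((\<lambda>f. f n) \<circ> (\<lambda>\<omega>. restrict (\<lambda>i. B i \<omega>) {n}))"
    by (intro indep_var_compose)
  moreover have "?F \<circ> (\<lambda>\<omega>. restrict (\<lambda>i. B i \<omega>) {..<n}) = walk p B n"
    by (auto simp: fun_eq_iff intro!: walk_cong)
  moreover have "(\<lambda>f. f n) \<circ> (\<lambda>\<omega>. restrict (\<lambda>i. B i \<omega>) {n}) = B n"
    by (auto simp: fun_eq_iff)
  ultimately have "indep_var (count_space UNIV) (walk p B n) (count_space UNIV) (B n)"
    by simp
  from indep_varD[OF this, of "{r}" "{\<beta>}"] show ?thesis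
    by (simp add: walk_prob_def vimage_def Int_def conj_commute)
qed

lemma walk_prob_Suc:
  assumes p: "p > 0" and abc: "a + b + c = 1"
  shows "walk_prob M p B (Suc n) s = (\<Sum>r\<in>{0..<int p}. walk_prob M p B n r *
     (a * of_bool ((2 * r + 1) mod int p = s) + b * of_bool ((2 * r) mod int p = s)
      + c * of_bool ((2 * r - 1) mod int p = s)))"
proof -
  let ?E = "\<lambda>\<beta>. {\<omega>\<in>space M. B n \<omega> = \<beta>}"
  let ?A = "\<lambda>(r, \<beta>). {\<omega>\<in>space M. (walk p B n \<omega> = r \<and> B n \<omega> = \<beta>) \<and> (2 * r + \<beta>) mod int p = s}"
  let ?I = "{0..<int p} \<times> {1, 0, -1 :: int}"
  \<comment> \<open>The three masses add up to one, so all other integer values of the increment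
    form a null event; the decomposition by increments below therefore holds almost
    everywhere.\<close>
  have "prob (\<Union>\<beta>\<in>{1, 0, -1}. ?E \<beta>) = (\<Sum>\<beta>\<in>{1, 0, -1}. prob (?E \<beta>))"
    by (rule finite_measure_finite_Union) (auto simp: disjoint_family_on_def)
  also have "\<dots> = 1"
    using prob_one[of n] prob_zero[of n] prob_minus_one[of n] abc by simp
  finally have "AE \<omega> in M. \<omega> \<in> (\<Union>\<beta>\<in>{1, 0, -1}. ?E \<beta>)"
    by (subst prob_eq_1[symmetric]) auto
  then have AE: "AE \<omega> in M. B n \<omega> \<in> {1, 0, -1}"
    by eventually_elim auto
  have "walk_prob M p B (Suc n) s = prob (\<Union>i\<in>?I. ?A i)"
    unfolding walk_prob_def
  proof (rule finite_measure_eq_AE)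
    show "AE \<omega> in M. (\<omega> \<in> {\<omega> \<in> space M. walk p B (Suc n) \<omega> = s}) = (\<omega> \<in> (\<Union>i\<in>?I. ?A i))"
      using AE
    proof eventually_elim
      case (elim \<omega>)
      then show ?case using walk_range[OF p, of B n \<omega>] by auto
    qed
  qed (measurable, auto)
  also have "\<dots> = (\<Sum>i\<in>?I. prob (?A i))"
    by (rule finite_measure_finite_Union) (auto simp: disjoint_family_on_def)
  also have "\<dots> = (\<Sum>r\<in>{0..<int p}. \<Sum>\<beta>\<in>{1, 0, -1}. prob (?A (r, \<beta>)))"
    by (subst sum.cartesian_product) (auto intro!: sum.cong)
  also have "\<dots> = (\<Sum>r\<in>{0..<int p}. \<Sum>\<beta>\<in>{1, 0, -1}.
      walk_prob M p B n r * \<P>(\<omega> in M. B n \<omega> = \<beta>) * of_bool ((2 * r + \<beta>) mod int p = s))"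
    by (intro sum.cong refl) (auto simp: prob_walk_increment)
  also have "\<dots> = (\<Sum>r\<in>{0..<int p}. walk_prob M p B n r *
     (a * of_bool ((2 * r + 1) mod int p = s) + b * of_bool ((2 * r) mod int p = s)
      + c * of_bool ((2 * r - 1) mod int p = s)))"
    by (intro sum.cong refl) (simp add: prob_one prob_zero prob_minus_one algebra_simps)
  finally show ?thesis .
qed

text \<open>The dual form of the recursion: one step is moved from the law of the walk onto the test
  function \<open>g\<close>, whose period absorbs the reduction mod \<open>p\<close>. Vector values
  serve real test functions and complex characters alike.\<close>

lemma walk_sum_Suc:
  fixes g :: "int \<Rightarrow> 'a::real_vector"
  assumes p: "p > 0" and abc: "a + b + c = 1" and g: "\<And>x. g (x mod int p) = g x"
  shows "(\<Sum>s\<in>{0..<int p}. walk_prob M p B (Suc n) s *\<^sub>R g s) =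
    (\<Sum>s\<in>{0..<int p}. walk_prob M p B n s *\<^sub>R
       (a *\<^sub>R g (2 * s + 1) + b *\<^sub>R g (2 * s) + c *\<^sub>R g (2 * s - 1)))"
proof -
  have "(\<Sum>s\<in>{0..<int p}. walk_prob M p B (Suc n) s *\<^sub>R g s)
     = (\<Sum>s\<in>{0..<int p}. \<Sum>r\<in>{0..<int p}. walk_prob M p B n r *\<^sub>R
     (a *\<^sub>R of_bool ((2 * r + 1) mod int p = s) *\<^sub>R g s + b *\<^sub>R of_bool ((2 * r) mod int p = s) *\<^sub>R g s
      + c *\<^sub>R of_bool ((2 * r - 1) mod int p = s) *\<^sub>R g s))"
    by (simp add: walk_prob_Suc[OF p abc] scaleR_sum_left scaleR_add_left scaleR_add_right algebra_simps del: of_bool_eq_iff)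
  also have "\<dots> = (\<Sum>r\<in>{0..<int p}. walk_prob M p B n r *\<^sub>R
     (a *\<^sub>R (\<Sum>s\<in>{0..<int p}. of_bool ((2 * r + 1) mod int p = s) *\<^sub>R g s)
      + b *\<^sub>R (\<Sum>s\<in>{0..<int p}. of_bool ((2 * r) mod int p = s) *\<^sub>R g s)
      + c *\<^sub>R (\<Sum>s\<in>{0..<int p}. of_bool ((2 * r - 1) mod int p = s) *\<^sub>R g s)))"
    by (subst sum.swap) (simp add: sum.distrib scaleR_sum_right[symmetric] del: scaleR_scaleR)
  also have "\<dots> = (\<Sum>s\<in>{0..<int p}. walk_prob M p B n s *\<^sub>R
       (a *\<^sub>R g (2 * s + 1) + b *\<^sub>R g (2 * s) + c *\<^sub>R g (2 * s - 1)))"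
    by (simp only: sum_mod_eq_shift[OF p] g)
  finally show ?thesis .
qed

lemma walk_sum_0:
  fixes g :: "int \<Rightarrow> 'a::real_vector"
  assumes p: "p > 0"
  shows "(\<Sum>s\<in>{0..<int p}. walk_prob M p B 0 s *\<^sub>R g s) = g 0"
proof -
  have "walk_prob M p B 0 s = of_bool (0 mod int p = s)" for s
    by (auto simp: walk_prob_def prob_space)
  then show ?thesis using sum_mod_eq_shift[OF p, of 0 g] by simp
qed

lemma sum_walk_prob:
  assumes p: "p > 0" and abc: "a + b + c = 1"
  shows "(\<Sum>s\<in>{0..<int p}. walk_prob M p B n s) = 1"
proof (induction n)
  case 0
  then show ?case using walk_sum_0[OF p, of "\<lambda>_. 1 :: real"] by simp
next
  case (Suc n)
  then show ?case
    using walk_sum_Suc[OF p abc, of "\<lambda>_. 1 :: real" n] abc by simp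
qed

end

lemma walk_prob_nonneg: "walk_prob M p B n s \<ge> 0"
  by (simp add: walk_prob_def)

section \<open>Fast mixing\<close>

lemma sum_lessThan_double:
  fixes f :: "nat \<Rightarrow> 'a::comm_monoid_add"
  shows "(\<Sum>v<2 * N. f v) = (\<Sum>u<N. f (2 * u) + f (2 * u + 1))"
  by (induction N) (simp_all add: add.assoc)

text \<open>The quotient by \<open>p\<close> jumps by one exactly at the multiples of
  \<open>p\<close>; this turns counts of multiples into telescoping sums.\<close>

lemma dvd_iff_div_diff:
  fixes p x :: int
  assumes "p > 0"
  shows "(of_bool (p dvd x) :: int) = x div p - (x - 1) div p"
proof -
  have eq: "p * (x div p - (x - 1) div p) = 1 + (x - 1) mod p - x mod p"
    using mult_div_mod_eq[of p x] mult_div_mod_eq[of p "x - 1"] by (simp add: algebra_simps)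
  have r: "x mod p \<ge> 0" "x mod p < p" "(x - 1) mod p \<ge> 0" "(x - 1) mod p < p"
    using assms by auto
  show ?thesis
  proof (cases "p dvd x")
    case True
    then have "x mod p = 0" by auto
    then have "p * (x div p - (x - 1) div p) > 0" "p * (x div p - (x - 1) div p) \<le> p * 1"
      using eq r by auto
    then have "x div p - (x - 1) div p = 1"
      using assms by (simp add: zero_less_mult_iff)
    then show ?thesis using True by simp
  next
    case False
    then have "x mod p > 0" using r by (simp add: mod_eq_0_iff_dvd order_less_le)
    then have "p * (x div p - (x - 1) div p) < p * 1" unfolding eq using r by linarith
    moreover have "p * (x div p - (x - 1) div p) > p * (-1)" unfolding eq using r by linarith
    ultimately have "x div p - (x - 1) div p = 0"
      using assms by (simp only: mult_less_cancel_left_pos)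
    then show ?thesis using False by simp
  qed
qed

text \<open>The count telescopes to a difference of two quotients. Replacing them by exact fractions
  costs a difference of two remainders, which is below \<open>p\<close> in absolute value for every
  length \<open>m\<close>.\<close>

lemma dvd_equidistribution:
  fixes p m :: nat and d :: int
  assumes "p > 0"
  shows "\<bar>\<Sum>u<m. of_bool (int p dvd int u + d) - 1 / real p\<bar> \<le> 1"
proof -
  let ?D = "(int m + d - 1) div int p - (d - 1) div int p"
  have tel: "(\<Sum>u<m. of_bool (int p dvd int u + d) :: int) = ?D"
    using assms by (induction m) (simp_all add: dvd_iff_div_diff algebra_simps)
  have "int p * ?D = int m + (d - 1) mod int p - (int m + d - 1) mod int p"
    using mult_div_mod_eq[of "int p" "int m + d - 1"] mult_div_mod_eq[of "int p" "d - 1"]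
    by (simp add: algebra_simps)
  moreover have "(d - 1) mod int p \<ge> 0" "(d - 1) mod int p < int p"
     "(int m + d - 1) mod int p \<ge> 0" "(int m + d - 1) mod int p < int p"
    using assms by auto
  ultimately have "\<bar>int p * ?D - int m\<bar> \<le> int p" by linarith
  then have "real_of_int \<bar>int p * ?D - int m\<bar> \<le> real_of_int (int p)"
    by (simp only: of_int_le_iff)
  then have *: "\<bar>real p * real_of_int ?D - real m\<bar> \<le> real p" by simp
  have "(\<Sum>u<m. of_bool (int p dvd int u + d) - 1 / real p) = real_of_int ?D - real m / real p"
    by (simp add: sum_subtractf flip: tel)
  also have "\<bar>\<dots>\<bar> = \<bar>real p * real_of_int ?D - real m\<bar> / real p"
  proof -
    have "real_of_int ?D - real m / real p = (real p * real_of_int ?D - real m) / real p"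
      using assms by (simp add: field_simps del: of_int_diff)
    then show ?thesis by simp
  qed
  also have "\<dots> \<le> 1" using * assms by (simp add: divide_le_eq)
  finally show ?thesis .
qed

text \<open>For odd \<open>p\<close> the number \<open>q = (p + 1) / 2\<close> is an inverse of 2
  mod \<open>p\<close>; multiplying by it reduces to blocks of consecutive integers.\<close>

lemma dvd_equidistribution_double:
  fixes p m :: nat and d :: int
  assumes "odd p"
  shows "\<bar>\<Sum>u<m. of_bool (int p dvd 2 * int u + d) - 1 / real p\<bar> \<le> 1"
proof -
  obtain q where q: "int p + 1 = 2 * q"
    using assms by (metis even_of_nat odd_even_add odd_one dvdE)
  have "int p dvd 2 * int u + d \<longleftrightarrow> int p dvd int u + q * d" for u
  proof
    assume "int p dvd 2 * int u + d"
    then have "int p dvd q * (2 * int u + d) - int p * int u" by simp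
    also have "q * (2 * int u + d) - int p * int u = (2 * q - int p) * int u + q * d"
      by (simp add: algebra_simps)
    finally show "int p dvd int u + q * d" by (simp flip: q)
  next
    assume "int p dvd int u + q * d"
    then have "int p dvd 2 * (int u + q * d) - int p * d" by (intro dvd_diff dvd_mult dvd_triv_left)
    also have "2 * (int u + q * d) - int p * d = 2 * int u + (2 * q - int p) * d"
      by (simp add: algebra_simps)
    finally show "int p dvd 2 * int u + d" by (simp flip: q)
  qed
  then show ?thesis using dvd_equidistribution[of p "q * d" m] assms by (auto simp: odd_pos)
qed

lemma periodic_double:
  fixes g :: "int \<Rightarrow> 'a" and p :: int
  assumes "\<And>x. g (x mod p) = g x"
  shows "g (2 * (x mod p) + k) = g (2 * x + k)"
proof -
  have "(2 * (x mod p) + k) mod p = (2 * x + k) mod p" by (rule mod_add_cong) (simp_all add: mod_mult_right_eq)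
  then show ?thesis
    using assms[of "2 * (x mod p) + k"] assms[of "2 * x + k"] by simp
qed

section \<open>Averaging test functions along the walk\<close>

context iid_increments
begin

text \<open>For \<open>b = 1/2\<close> the increments are a fair bit minus an independent biased bit, so
  \<open>walk p B n\<close> is a uniform element of \<open>{0..<2 ^ n}\<close> plus an independent shift.\<close>

lemma walk_sum_bound_half:
  fixes g :: "int \<Rightarrow> real"
  assumes p: "p > 0" and ac: "a \<ge> 0" "c \<ge> 0" "a + c = 1 / 2" and b: "b = 1 / 2"
    and g: "\<And>x. g (x mod int p) = g x"
    and C: "\<And>d. \<bar>\<Sum>u<2 ^ n. g (int u + d)\<bar> \<le> C"
  shows "\<bar>\<Sum>s\<in>{0..<int p}. walk_prob M p B n s * g s\<bar> \<le> C / 2 ^ n"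
  using g C
proof (induction n arbitrary: g C)
  case 0
  then show ?case using walk_sum_0[OF p, of g] "0.prems"(2)[of 0] by simp
next
  case (Suc n)
  have abc: "a + b + c = 1" using ac b by simp
  let ?g = "\<lambda>x. a * g (2 * x + 1) + b * g (2 * x) + c * g (2 * x - 1)"
  have per: "?g (x mod int p) = ?g x" for x
    using periodic_double[where g = g and k = 1, OF Suc.prems(1)]
      periodic_double[where g = g and k = 0, OF Suc.prems(1)]
      periodic_double[where g = g and k = "-1", OF Suc.prems(1)] by simp
  have bound: "\<bar>\<Sum>u<2 ^ n. ?g (int u + d)\<bar> \<le> C / 2" for d
  proof -
    have bb: "b = a + c" using ac b by simp
    \<comment> \<open>With \<open>b = a + c\<close> the weight of \<open>g (2 * x)\<close> is shared
      between its two neighbours. Each share pairs consecutive arguments, so the block turns into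
      two blocks of doubled length, starting at \<open>2 * d\<close> and \<open>2 * d - 1\<close>,
      with total weight 1/2.\<close>
    have "(\<Sum>u<2 ^ n. ?g (int u + d))
        = a * (\<Sum>u<2 * 2 ^ n. g (int u + 2 * d)) + c * (\<Sum>u<2 * 2 ^ n. g (int u + (2 * d - 1)))"
      unfolding sum_lessThan_double sum_distrib_left sum.distrib[symmetric]
      by (intro sum.cong) (simp_all add: bb algebra_simps)
    also have "\<bar>\<dots>\<bar> \<le> a * C + c * C"
      using Suc.prems(2)[of "2 * d"] Suc.prems(2)[of "2 * d - 1"] ac
      by (intro order_trans[OF abs_triangle_ineq] add_mono) (auto simp: abs_mult intro!: mult_left_mono)
    also have "\<dots> = (a + c) * C" by (rule distrib_right[symmetric])
    also have "\<dots> = C / 2" using ac by simp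
    finally show ?thesis .
  qed
  have "(\<Sum>s\<in>{0..<int p}. walk_prob M p B (Suc n) s * g s)
      = (\<Sum>s\<in>{0..<int p}. walk_prob M p B n s * ?g s)"
    using walk_sum_Suc[OF p abc, of g n, OF Suc.prems(1)] by (simp only: real_scaleR_def)
  then show ?case
    using Suc.IH[of ?g "C / 2", OF per bound] by (simp only: power_Suc divide_divide_eq_left)
qed

text \<open>Here the increments are twice a fair bit minus one.\<close>

lemma walk_sum_bound_symmetric:
  fixes g :: "int \<Rightarrow> real"
  assumes p: "p > 0" and abc: "a = 1 / 2" "b = 0" "c = 1 / 2"
    and g: "\<And>x. g (x mod int p) = g x"
    and C: "\<And>d. \<bar>\<Sum>u<2 ^ n. g (2 * int u + d)\<bar> \<le> C"
  shows "\<bar>\<Sum>s\<in>{0..<int p}. walk_prob M p B n s * g s\<bar> \<le> C / 2 ^ n"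
  using g C
proof (induction n arbitrary: g C)
  case 0
  then show ?case using walk_sum_0[OF p, of g] "0.prems"(2)[of 0] by simp
next
  case (Suc n)
  have abc1: "a + b + c = 1" using abc by simp
  let ?g = "\<lambda>x. a * g (2 * x + 1) + b * g (2 * x) + c * g (2 * x - 1)"
  have per: "?g (x mod int p) = ?g x" for x
    using periodic_double[where g = g and k = 1, OF Suc.prems(1)]
      periodic_double[where g = g and k = 0, OF Suc.prems(1)]
      periodic_double[where g = g and k = "-1", OF Suc.prems(1)] by simp
  have bound: "\<bar>\<Sum>u<2 ^ n. ?g (2 * int u + d)\<bar> \<le> C / 2" for d
  proof -
    \<comment> \<open>The arguments \<open>2 * (2 * u + d) - 1\<close> and
      \<open>2 * (2 * u + d) + 1\<close> differ by two, so together they form a progression of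
      difference two and doubled length, starting at \<open>2 * d - 1\<close>.\<close>
    have "(\<Sum>u<2 ^ n. ?g (2 * int u + d))
        = 1 / 2 * (\<Sum>u<2 * 2 ^ n. g (2 * int u + (2 * d - 1)))"
      unfolding sum_lessThan_double sum_distrib_left
      by (intro sum.cong) (simp_all add: abc algebra_simps)
    also have "\<bar>\<dots>\<bar> \<le> C / 2" using Suc.prems(2)[of "2 * d - 1"] by simp
    finally show ?thesis .
  qed
  have "(\<Sum>s\<in>{0..<int p}. walk_prob M p B (Suc n) s * g s)
      = (\<Sum>s\<in>{0..<int p}. walk_prob M p B n s * ?g s)"
    using walk_sum_Suc[OF p abc1, of g n, OF Suc.prems(1)] by (simp only: real_scaleR_def)
  then show ?case
    using Suc.IH[of ?g "C / 2", OF per bound] by (simp only: power_Suc divide_divide_eq_left)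
qed

lemma walk_prob_near_uniform:
  assumes p: "odd p" and ac: "a \<ge> 0" "c \<ge> 0" "a + b + c = 1"
    and case1: "b = 0 \<and> a = 1 / 2 \<and> c = 1 / 2 \<or> b = 1 / 2" and s: "s \<in> {0..<int p}"
  shows "\<bar>walk_prob M p B n s - 1 / real p\<bar> \<le> 1 / 2 ^ n"
proof -
  have p0: "p > 0" using p by (rule odd_pos)
  \<comment> \<open>The centred indicator of the residue class of \<open>s\<close>: its sums along
    progressions of any length are bounded by 1, so the halving estimates apply with
    \<open>C = 1\<close>.\<close>
  let ?g = "\<lambda>x. of_bool (int p dvd x - s) - 1 / real p"
  have per: "?g (x mod int p) = ?g x" for x
    by (simp only: mod_eq_dvd_iff[symmetric] mod_mod_trivial)
  have "\<bar>\<Sum>r\<in>{0..<int p}. walk_prob M p B n r * ?g r\<bar> \<le> 1 / 2 ^ n"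
    using case1
  proof
    assume "b = 1 / 2"
    moreover have "\<bar>\<Sum>u<2 ^ n. ?g (int u + d)\<bar> \<le> 1" for d :: int
      using dvd_equidistribution[OF p0, of "d - s" "2 ^ n"] by (simp only: add_diff_eq)
    ultimately show ?thesis
      using ac by (intro walk_sum_bound_half[where g = ?g, OF p0] per) auto
  next
    assume "b = 0 \<and> a = 1 / 2 \<and> c = 1 / 2"
    moreover have "\<bar>\<Sum>u<2 ^ n. ?g (2 * int u + d)\<bar> \<le> 1" for d :: int
      using dvd_equidistribution_double[OF p, of "d - s" "2 ^ n"] by (simp only: add_diff_eq)
    ultimately show ?thesis
      by (intro walk_sum_bound_symmetric[where g = ?g, OF p0] per) auto
  qed
  also have "(\<Sum>r\<in>{0..<int p}. walk_prob M p B n r * ?g r)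
      = (\<Sum>r\<in>{0..<int p}. if r = s then walk_prob M p B n r else 0) - 1 / real p"
  proof -
    have "(\<Sum>r\<in>{0..<int p}. walk_prob M p B n r * ?g r)
      = (\<Sum>r\<in>{0..<int p}. (if r = s then walk_prob M p B n r else 0) - walk_prob M p B n r / real p)"
    proof (intro sum.cong refl)
      fix r assume "r \<in> {0..<int p}"
      then have "int p dvd r - s \<longleftrightarrow> r = s"
        using s unfolding mod_eq_dvd_iff[symmetric] by simp
      then show "walk_prob M p B n r * ?g r
          = (if r = s then walk_prob M p B n r else 0) - walk_prob M p B n r / real p"
        by (simp add: algebra_simps)
    qed
    then show ?thesis
      using sum_walk_prob[OF p0 ac(3), of n] by (simp add: sum_subtractf flip: sum_divide_distrib)
  qed
  finally show ?thesis using s by simp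
qed

lemma unif_dist_le:
  assumes "odd p" "a \<ge> 0" "c \<ge> 0" "a + b + c = 1"
    and "b = 0 \<and> a = 1 / 2 \<and> c = 1 / 2 \<or> b = 1 / 2"
  shows "unif_dist {0..<int p} (walk_prob M p B n) \<le> real p / 2 ^ n"
proof -
  have "(\<Sum>s\<in>{0..<int p}. \<bar>walk_prob M p B n s - 1 / real p\<bar>) \<le> (\<Sum>s\<in>{0..<int p}. 1 / 2 ^ n)"
    by (intro sum_mono walk_prob_near_uniform[OF assms])
  also have "\<dots> = real p / 2 ^ n" by simp
  finally have "(\<Sum>s\<in>{0..<int p}. \<bar>walk_prob M p B n s - 1 / real p\<bar>) \<le> real p / 2 ^ n" .
  moreover have "0 \<le> real p / 2 ^ n" by simp
  ultimately have "1 / 2 * (\<Sum>s\<in>{0..<int p}. \<bar>walk_prob M p B n s - 1 / real p\<bar>) \<le> real p / 2 ^ n"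
    by linarith
  then show ?thesis by (simp add: unif_dist_def)
qed

end

text \<open>The condition on \<open>n\<close> says \<open>2 ^ n > p powr c\<^sub>1\<close>, so the
  bound \<open>p / 2 ^ n\<close> is at most \<open>p powr (1 - c\<^sub>1)\<close>, a negative power
  of \<open>p\<close>.\<close>

lemma mixing_case1:
  fixes a b c :: real
  assumes abc: "a \<ge> 0" "c \<ge> 0" "a + b + c = 1"
    and case1: "b = 0 \<and> a = 1 / 2 \<and> c = 1 / 2 \<or> b = 1 / 2"
    and c1: "c\<^sub>1 > 1" and eps: "\<epsilon> > 0"
  shows "\<exists>p\<^sub>0 :: nat. \<forall>p \<ge> p\<^sub>0. odd p \<longrightarrow>
          (\<forall>(M :: 'w measure) B. iid_increments M B a b c \<longrightarrow>
            (\<forall>n :: nat. real n > c\<^sub>1 * log 2 (real p) \<longrightarrow>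
              unif_dist {0..<int p} (walk_prob M p B n) < \<epsilon>))"
proof -
  have "((\<lambda>p. real p powr (1 - c\<^sub>1)) \<longlongrightarrow> 0) at_top"
    using c1 by (intro tendsto_neg_powr filterlim_real_sequentially) simp
  then have "\<forall>\<^sub>F p in at_top. real p powr (1 - c\<^sub>1) < \<epsilon>"
    using eps by (rule order_tendstoD)
  then obtain p\<^sub>0 where p0: "\<And>p. p \<ge> p\<^sub>0 \<Longrightarrow> real p powr (1 - c\<^sub>1) < \<epsilon>"
    by (auto simp: eventually_at_top_linorder)
  have "unif_dist {0..<int p} (walk_prob M p B n) < \<epsilon>"
    if "p \<ge> p\<^sub>0" "odd p" "iid_increments M B a b c" "real n > c\<^sub>1 * log 2 (real p)"
    for p n :: nat and M :: "'w measure" and B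
  proof -
    interpret iid_increments M B a b c by fact
    have p: "real p > 0" using \<open>odd p\<close> by (simp add: odd_pos)
    have "unif_dist {0..<int p} (walk_prob M p B n) \<le> real p / 2 ^ n"
      using \<open>odd p\<close> abc case1 by (rule unif_dist_le)
    also have "\<dots> \<le> real p / real p powr c\<^sub>1"
    proof (rule divide_left_mono)
      have "real p powr c\<^sub>1 = 2 powr (c\<^sub>1 * log 2 (real p))"
        using p by (subst mult.commute, subst powr_powr[symmetric]) simp
      also have "\<dots> \<le> 2 powr real n" using that(4) by simp
      finally show "real p powr c\<^sub>1 \<le> 2 ^ n" by (simp add: powr_realpow)
    qed (use p in auto)
    also have "\<dots> = real p powr (1 - c\<^sub>1)" using p by (simp add: powr_diff)
    also have "\<dots> < \<epsilon>" using p0 that(1) by blast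
    finally show ?thesis .
  qed
  then show ?thesis by blast
qed

section \<open>Characters and second moments\<close>

lemma norm_cis_diff: "norm (cis x - cis y) \<le> \<bar>x - y\<bar>"
proof -
  have "cis x - cis y = cis y * (exp (\<i> * of_real (x - y)) - 1)"
    unfolding cis_conv_exp[symmetric] by (simp add: right_diff_distrib cis_mult)
  then have "norm (cis x - cis y) = 2 * \<bar>sin ((x - y) / 2)\<bar>"
    by (simp only: norm_mult norm_cis dist_exp_i_1)
  also have "\<dots> \<le> 2 * \<bar>(x - y) / 2\<bar>"
    by (intro mult_left_mono abs_sin_x_le_abs_x) simp
  finally show ?thesis by simp
qed

lemma cis_int_shift: "cis (2 * pi * (x + of_int k)) = cis (2 * pi * x)"
proof -
  have "cis (2 * pi * (x + of_int k)) = cis (2 * pi * x) * cis (2 * pi * of_int k)"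
    by (simp only: cis_mult distrib_left)
  then show ?thesis by simp
qed

text \<open>The characteristic function of a single increment, with \<open>x\<close> counted in full
  turns so that the period is one.\<close>

definition step_char :: "real \<Rightarrow> real \<Rightarrow> real \<Rightarrow> real \<Rightarrow> complex" where
  "step_char a b c x = of_real a * cis (2 * pi * x) + of_real b + of_real c * cis (- (2 * pi * x))"

lemma step_char_0: "a + b + c = 1 \<Longrightarrow> step_char a b c 0 = 1"
  by (simp add: step_char_def flip: of_real_add)

lemma step_char_minus: "step_char a b c (- x) = cnj (step_char a b c x)"
  by (simp add: step_char_def cis_cnj)

lemma step_char_int_shift: "step_char a b c (x + of_int k) = step_char a b c x"
  using cis_int_shift[of x k] cis_int_shift[of "-x" "-k"] by (simp add: step_char_def algebra_simps)

lemma norm_step_char_le_1: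
  assumes "a \<ge> 0" "b \<ge> 0" "c \<ge> 0" "a + b + c = 1"
  shows "norm (step_char a b c x) \<le> 1"
proof -
  have "norm (step_char a b c x) \<le> norm (of_real a * cis (2 * pi * x)) + norm (of_real b :: complex)
      + norm (of_real c * cis (- (2 * pi * x)))"
    unfolding step_char_def by (intro norm_triangle_mono order_refl)
  then show ?thesis using assms by (simp add: norm_mult)
qed

lemma step_char_lipschitz:
  assumes "a \<ge> 0" "b \<ge> 0" "c \<ge> 0" "a + b + c = 1"
  shows "norm (step_char a b c x - step_char a b c y) \<le> 2 * pi * \<bar>x - y\<bar>"
proof -
  have "step_char a b c x - step_char a b c y =
      of_real a * (cis (2 * pi * x) - cis (2 * pi * y))
      + of_real c * (cis (- (2 * pi * x)) - cis (- (2 * pi * y)))"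
    by (simp add: step_char_def algebra_simps)
  also have "norm \<dots> \<le> a * \<bar>2 * pi * x - 2 * pi * y\<bar> + c * \<bar>- (2 * pi * x) - - (2 * pi * y)\<bar>"
    by (intro norm_triangle_mono)
      (simp_all only: norm_mult norm_of_real abs_of_nonneg[OF assms(1)] abs_of_nonneg[OF assms(3)]
        mult_left_mono[OF norm_cis_diff assms(1)] mult_left_mono[OF norm_cis_diff assms(3)])
  also have "\<dots> = (a + c) * (2 * pi * \<bar>x - y\<bar>)"
  proof -
    have "2 * pi * x - 2 * pi * y = 2 * pi * (x - y)"
      "- (2 * pi * x) - - (2 * pi * y) = 2 * pi * - (x - y)"
      by (simp_all add: algebra_simps)
    then have "\<bar>2 * pi * x - 2 * pi * y\<bar> = 2 * pi * \<bar>x - y\<bar>"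
      "\<bar>- (2 * pi * x) - - (2 * pi * y)\<bar> = 2 * pi * \<bar>x - y\<bar>"
      by (simp_all only: abs_mult abs_minus_cancel) simp_all
    then show ?thesis by (simp only: distrib_right)
  qed
  also have "\<dots> \<le> 1 * (2 * pi * \<bar>x - y\<bar>)"
    using assms by (intro mult_right_mono) auto
  finally show ?thesis by simp
qed

text \<open>Near 0 the characteristic function is close to 1, so it is almost multiplicative when
  one argument is small; two Lipschitz errors of \<open>2 * pi\<close> times that argument arise.
  Either of \<open>x\<close> and \<open>- y\<close> may be taken as the small one, whence the
  minimum.\<close>

lemma step_char_diff_approx:
  assumes abc: "a \<ge> 0" "b \<ge> 0" "c \<ge> 0" "a + b + c = 1"
  shows "norm (step_char a b c (x - y) - step_char a b c x * cnj (step_char a b c y))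
    \<le> 4 * pi * min \<bar>x\<bar> \<bar>y\<bar>"
proof -
  let ?h = "step_char a b c"
  have le: "norm (?h (u + v) - ?h u * ?h v) \<le> 4 * pi * \<bar>v\<bar>" for u v
  proof -
    have "?h (u + v) - ?h u * ?h v = (?h (u + v) - ?h u) + ?h u * (?h 0 - ?h v)"
      using step_char_0[OF abc(4)] by (simp add: algebra_simps)
    also have "norm \<dots> \<le> 2 * pi * \<bar>v\<bar> + 1 * (2 * pi * \<bar>v\<bar>)"
    proof (rule norm_triangle_mono)
      show "norm (?h (u + v) - ?h u) \<le> 2 * pi * \<bar>v\<bar>"
        using step_char_lipschitz[OF abc, of "u + v" u] by simp
      have "norm (?h 0 - ?h v) \<le> 2 * pi * \<bar>v\<bar>"
        using step_char_lipschitz[OF abc, of 0 v] by simp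
      then show "norm (?h u * (?h 0 - ?h v)) \<le> 1 * (2 * pi * \<bar>v\<bar>)"
        unfolding norm_mult by (intro mult_mono norm_step_char_le_1[OF abc]) auto
    qed
    finally show ?thesis by simp
  qed
  have "norm (?h (x - y) - ?h x * cnj (?h y)) \<le> 4 * pi * \<bar>x\<bar>"
    using le[of "- y" x] by (simp add: step_char_minus mult.commute)
  moreover have "norm (?h (x - y) - ?h x * cnj (?h y)) \<le> 4 * pi * \<bar>y\<bar>"
    using le[of x "- y"] by (simp add: step_char_minus)
  ultimately show ?thesis by (simp add: min_def)
qed

text \<open>Averaging over the last increment splits off the factor at \<open>k / p\<close> and
  leaves the walk with one step less at frequency \<open>2 * k\<close>; hence the induction for all
  \<open>k\<close> at once.\<close>

lemma (in iid_increments) walk_fourier: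
  assumes p: "p > 0" and abc: "a + b + c = 1"
  shows "(\<Sum>s\<in>{0..<int p}. walk_prob M p B n s *\<^sub>R cis (2 * pi * (of_int k * of_int s / real p)))
    = (\<Prod>i<n. step_char a b c (2 ^ i * of_int k / real p))"
proof (induction n arbitrary: k)
  case 0
  then show ?case
    using walk_sum_0[OF p, of "\<lambda>s. cis (2 * pi * (of_int k * of_int s / real p))"] by simp
next
  case (Suc n)
  let ?e = "\<lambda>k s. cis (2 * pi * (of_int k * of_int s / real p))"
  have per: "?e k (s mod int p) = ?e k s" for s
  proof -
    have "real_of_int s = real p * of_int (s div int p) + of_int (s mod int p)"
      by (metis of_int_add of_int_mult of_int_of_nat_eq mult_div_mod_eq)
    then have "of_int k * of_int s / real p
        = of_int k * of_int (s mod int p) / real p + of_int (k * (s div int p))"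
      using p by (simp add: field_simps)
    then show ?thesis by (simp only: cis_int_shift)
  qed
  have step: "a *\<^sub>R ?e k (2 * s + 1) + b *\<^sub>R ?e k (2 * s) + c *\<^sub>R ?e k (2 * s - 1)
      = step_char a b c (of_int k / real p) * ?e (2 * k) s" for s
    by (simp add: step_char_def scaleR_conv_of_real algebra_simps cis_mult add_divide_distrib diff_divide_distrib)
  have "(\<Sum>s\<in>{0..<int p}. walk_prob M p B (Suc n) s *\<^sub>R ?e k s)
     = (\<Sum>s\<in>{0..<int p}. walk_prob M p B n s *\<^sub>R (step_char a b c (of_int k / real p) * ?e (2 * k) s))"
    by (subst walk_sum_Suc[OF p abc, of "?e k", OF per]) (simp only: step)
  also have "\<dots> = step_char a b c (of_int k / real p) * (\<Sum>s\<in>{0..<int p}. walk_prob M p B n s *\<^sub>R ?e (2 * k) s)"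
    by (simp add: sum_distrib_left)
  also have "\<dots> = (\<Prod>i<Suc n. step_char a b c (2 ^ i * of_int k / real p))"
    unfolding Suc.IH prod.lessThan_Suc_shift by (simp add: mult_ac)
  finally show ?case .
qed

text \<open>Shifting a full period by one place replaces its first term by an equal one at the other
  end. The locale \<open>comm_monoid_set\<close> yields the fact for sums and products
  alike.\<close>

lemma (in comm_monoid_set) periodic_shift:
  fixes g :: "nat \<Rightarrow> 'a"
  assumes "\<And>m. g (m + t) = g m"
  shows "F (\<lambda>i. g (i + j)) {..<t} = F g {..<t}"
proof (cases t)
  case (Suc u)
  show ?thesis
  proof (induction j)
    case (Suc j)
    have "F (\<lambda>i. g (i + Suc j)) {..<t} = f (F (\<lambda>i. g (Suc i + j)) {..<u}) (g (j + t))"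
      by (simp add: \<open>t = Suc u\<close> add_ac)
    also have "\<dots> = f (g (0 + j)) (F (\<lambda>i. g (Suc i + j)) {..<u})"
      by (simp add: assms commute)
    also have "\<dots> = F (\<lambda>i. g (i + j)) {..<t}"
      unfolding \<open>t = Suc u\<close> by (rule lessThan_Suc_shift[symmetric])
    finally show ?case using Suc.IH by simp
  qed simp
qed simp

text \<open>Shifting the summation by one leaves the sum unchanged but also multiplies it by
  \<open>?w\<close>, which is not 1 because \<open>p\<close> does not divide
  \<open>k\<close>.\<close>

lemma sum_cis_eq_0:
  assumes p: "p > 0" and k: "\<not> int p dvd k"
  shows "(\<Sum>s\<in>{0..<int p}. cis (2 * pi * (of_int k * of_int s / real p))) = 0"
proof -
  let ?g = "\<lambda>i::nat. cis (2 * pi * (of_int k * real i / real p))"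
  let ?w = "cis (2 * pi * (of_int k / real p))"
  have S: "(\<Sum>s\<in>{0..<int p}. cis (2 * pi * (of_int k * of_int s / real p))) = (\<Sum>i<p. ?g i)"
    by (rule sum.reindex_bij_witness[of _ int nat]) auto
  have "?g (m + p) = ?g m" for m
    using cis_int_shift[of "of_int k * real m / real p" k] p
    by (simp add: field_simps)
  then have "(\<Sum>i<p. ?g i) = (\<Sum>i<p. ?g (i + 1))"
    by (rule sum.periodic_shift[symmetric])
  also have "\<dots> = ?w * (\<Sum>i<p. ?g i)"
    unfolding sum_distrib_left by (intro sum.cong refl) (simp add: cis_mult algebra_simps add_divide_distrib)
  finally have "(?w - 1) * (\<Sum>i<p. ?g i) = 0" by (simp add: algebra_simps)
  moreover have "?w \<noteq> 1"
  proof
    assume "?w = 1"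
    then have "cos (2 * pi * (of_int k / real p)) = 1" by (simp add: complex_eq_iff)
    then obtain m :: int where "2 * pi * (of_int k / real p) = of_int m * 2 * pi"
      by (auto simp: cos_one_2pi_int)
    then have "real_of_int k = of_int (m * int p)" using p by (simp add: field_simps)
    then have "k = m * int p" by (simp only: of_int_eq_iff)
    then show False using k by simp
  qed
  ultimately show ?thesis unfolding S by simp
qed

text \<open>Expanding the square gives a double sum of covariances with coefficients of modulus one.
  The weights \<open>P\<close> are general so as to cover both the law of the walk and the uniform
  distribution.\<close>

lemma variance_le_sum_covariances:
  fixes e :: "'j \<Rightarrow> 's \<Rightarrow> complex" and \<alpha> \<mu> :: "'j \<Rightarrow> complex" and P :: "'s \<Rightarrow> real"
  assumes total: "(\<Sum>s\<in>G. P s) = 1"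
    and \<mu>: "\<And>j. j \<in> J \<Longrightarrow> (\<Sum>s\<in>G. P s *\<^sub>R e j s) = \<mu> j"
    and \<alpha>: "\<And>j. j \<in> J \<Longrightarrow> norm (\<alpha> j) = 1"
  shows "(\<Sum>s\<in>G. P s * (norm ((\<Sum>j\<in>J. \<alpha> j * e j s) - (\<Sum>j\<in>J. \<alpha> j * \<mu> j)))\<^sup>2)
    \<le> (\<Sum>j\<in>J. \<Sum>k\<in>J. norm ((\<Sum>s\<in>G. P s *\<^sub>R (e j s * cnj (e k s))) - \<mu> j * cnj (\<mu> k)))"
proof -
  let ?cov = "\<lambda>j k. (\<Sum>s\<in>G. P s *\<^sub>R (e j s * cnj (e k s))) - \<mu> j * cnj (\<mu> k)"
  have cov: "(\<Sum>s\<in>G. P s *\<^sub>R ((e j s - \<mu> j) * cnj (e k s - \<mu> k))) = ?cov j k"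
    if "j \<in> J" "k \<in> J" for j k
  proof -
    have "(\<Sum>s\<in>G. P s *\<^sub>R ((e j s - \<mu> j) * cnj (e k s - \<mu> k)))
       = (\<Sum>s\<in>G. P s *\<^sub>R (e j s * cnj (e k s))) - (\<Sum>s\<in>G. P s *\<^sub>R e j s) * cnj (\<mu> k)
         - \<mu> j * cnj (\<Sum>s\<in>G. P s *\<^sub>R e k s) + (\<Sum>s\<in>G. P s) *\<^sub>R (\<mu> j * cnj (\<mu> k))"
      by (simp add: algebra_simps sum.distrib sum_subtractf sum_distrib_left sum_distrib_right
          scaleR_sum_left)
    then show ?thesis using total \<mu>[OF that(1)] \<mu>[OF that(2)] by simp
  qed
  have sq: "complex_of_real ((norm ((\<Sum>j\<in>J. \<alpha> j * e j s) - (\<Sum>j\<in>J. \<alpha> j * \<mu> j)))\<^sup>2)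
     = (\<Sum>j\<in>J. \<Sum>k\<in>J. \<alpha> j * cnj (\<alpha> k) * ((e j s - \<mu> j) * cnj (e k s - \<mu> k)))" for s
  proof -
    have D: "(\<Sum>j\<in>J. \<alpha> j * e j s) - (\<Sum>j\<in>J. \<alpha> j * \<mu> j) = (\<Sum>j\<in>J. \<alpha> j * (e j s - \<mu> j))"
      by (simp add: sum_subtractf right_diff_distrib)
    show ?thesis
      unfolding D complex_norm_square cnj_sum sum_product by (simp add: mult_ac)
  qed
  have "complex_of_real (\<Sum>s\<in>G. P s * (norm ((\<Sum>j\<in>J. \<alpha> j * e j s) - (\<Sum>j\<in>J. \<alpha> j * \<mu> j)))\<^sup>2)
     = (\<Sum>s\<in>G. P s *\<^sub>R (\<Sum>j\<in>J. \<Sum>k\<in>J. \<alpha> j * cnj (\<alpha> k) * ((e j s - \<mu> j) * cnj (e k s - \<mu> k))))"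
    by (simp only: of_real_sum of_real_mult sq scaleR_conv_of_real)
  also have "\<dots> = (\<Sum>s\<in>G. \<Sum>j\<in>J. \<Sum>k\<in>J. \<alpha> j * cnj (\<alpha> k) * (P s *\<^sub>R ((e j s - \<mu> j) * cnj (e k s - \<mu> k))))"
    by (simp only: scaleR_sum_right mult_scaleR_right)
  also have "\<dots> = (\<Sum>j\<in>J. \<Sum>k\<in>J. \<Sum>s\<in>G. \<alpha> j * cnj (\<alpha> k) * (P s *\<^sub>R ((e j s - \<mu> j) * cnj (e k s - \<mu> k))))"
    by (subst sum.swap, rule sum.cong[OF refl], rule sum.swap)
  also have "\<dots> = (\<Sum>j\<in>J. \<Sum>k\<in>J. \<alpha> j * cnj (\<alpha> k) * ?cov j k)"
  proof (intro sum.cong refl)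
    fix j k assume jk: "j \<in> J" "k \<in> J"
    show "(\<Sum>s\<in>G. \<alpha> j * cnj (\<alpha> k) * (P s *\<^sub>R ((e j s - \<mu> j) * cnj (e k s - \<mu> k))))
        = \<alpha> j * cnj (\<alpha> k) * ?cov j k"
      unfolding cov[OF jk, symmetric] by (rule sum_distrib_left[symmetric])
  qed
  finally have eq: "complex_of_real (\<Sum>s\<in>G. P s * (norm ((\<Sum>j\<in>J. \<alpha> j * e j s) - (\<Sum>j\<in>J. \<alpha> j * \<mu> j)))\<^sup>2)
      = (\<Sum>j\<in>J. \<Sum>k\<in>J. \<alpha> j * cnj (\<alpha> k) * ?cov j k)" .
  have "\<bar>\<Sum>s\<in>G. P s * (norm ((\<Sum>j\<in>J. \<alpha> j * e j s) - (\<Sum>j\<in>J. \<alpha> j * \<mu> j)))\<^sup>2\<bar>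
      = norm (\<Sum>j\<in>J. \<Sum>k\<in>J. \<alpha> j * cnj (\<alpha> k) * ?cov j k)"
    unfolding eq[symmetric] norm_of_real ..
  also have "\<dots> \<le> (\<Sum>j\<in>J. \<Sum>k\<in>J. norm (?cov j k))"
    using \<alpha> by (intro sum_norm_le) (simp add: norm_mult)
  finally show ?thesis by linarith
qed

text \<open>The distance is one minus the total mass of the pointwise minimum of the two laws. On
  this common part \<open>f\<close> would have to be close to both \<open>m\<close> and 0, which the
  second moments limit.\<close>

lemma unif_dist_ge:
  fixes f :: "'s \<Rightarrow> complex" and m :: complex
  assumes G: "finite G" "G \<noteq> {}" and P: "\<And>s. P s \<ge> 0" "(\<Sum>s\<in>G. P s) = 1" and m: "m \<noteq> 0"
    and VP: "(\<Sum>s\<in>G. P s * (norm (f s - m))\<^sup>2) \<le> VP"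
    and VU: "(\<Sum>s\<in>G. 1 / real (card G) * (norm (f s))\<^sup>2) \<le> VU"
  shows "unif_dist G P \<ge> 1 - 2 * (VP + VU) / (norm m)\<^sup>2"
proof -
  let ?u = "1 / real (card G)"
  have card: "card G > 0" using G by (simp add: card_gt_0_iff)
  have "(\<Sum>s\<in>G. \<bar>P s - ?u\<bar>) = (\<Sum>s\<in>G. P s + ?u - 2 * min (P s) ?u)"
    by (intro sum.cong) (auto simp: min_def)
  also have "\<dots> = 2 - 2 * (\<Sum>s\<in>G. min (P s) ?u)"
    using P card by (simp add: sum_subtractf sum.distrib sum_distrib_left)
  finally have dist: "unif_dist G P = 1 - (\<Sum>s\<in>G. min (P s) ?u)"
    by (simp add: unif_dist_def)
  have "(\<Sum>s\<in>G. min (P s) ?u) * ((norm m)\<^sup>2 / 2) = (\<Sum>s\<in>G. min (P s) ?u * ((norm m)\<^sup>2 / 2))"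
    by (rule sum_distrib_right)
  also have "\<dots> \<le> (\<Sum>s\<in>G. P s * (norm (f s - m))\<^sup>2 + ?u * (norm (f s))\<^sup>2)"
  proof (rule sum_mono)
    fix s
    have "norm m \<le> norm (f s - m) + norm (f s)"
      using norm_triangle_ineq4[of "f s" "f s - m"] by simp
    then have "(norm m)\<^sup>2 \<le> (norm (f s - m) + norm (f s))\<^sup>2"
      by (intro power_mono) auto
    also have "\<dots> \<le> 2 * ((norm (f s - m))\<^sup>2 + (norm (f s))\<^sup>2)"
      using sum_squares_bound[of "norm (f s - m)" "norm (f s)"] by (simp add: power2_sum)
    finally have "min (P s) ?u * ((norm m)\<^sup>2 / 2)
        \<le> min (P s) ?u * ((norm (f s - m))\<^sup>2 + (norm (f s))\<^sup>2)"
      using P(1)[of s] by (intro mult_left_mono) auto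
    also have "\<dots> \<le> P s * (norm (f s - m))\<^sup>2 + ?u * (norm (f s))\<^sup>2"
      unfolding distrib_left by (intro add_mono mult_right_mono) auto
    finally show "min (P s) ?u * ((norm m)\<^sup>2 / 2)
        \<le> P s * (norm (f s - m))\<^sup>2 + ?u * (norm (f s))\<^sup>2" .
  qed
  also have "\<dots> \<le> VP + VU" unfolding sum.distrib using VP VU by (rule add_mono)
  finally have "(\<Sum>s\<in>G. min (P s) ?u) \<le> 2 * (VP + VU) / (norm m)\<^sup>2"
    using m by (simp add: field_simps)
  then show ?thesis using dist by simp
qed

text \<open>Passing from \<open>t\<close> to \<open>Suc t\<close> adds two geometric borders and a
  corner, together at most \<open>3 * 2 ^ t\<close>. The double sum thus has the order of its
  largest term, which keeps the total covariance added per time step bounded.\<close>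

lemma sum_min_powers:
  "(\<Sum>j<t. \<Sum>k<t. min (2 ^ j) (2 ^ k) :: real) \<le> 3 * 2 ^ t"
proof (induction t)
  case (Suc t)
  have geo: "(\<Sum>j<t. 2 ^ j :: real) = 2 ^ t - 1"
    by (simp add: sum_gp_strict)
  have m: "(\<Sum>j<t. min (2 ^ j) (2 ^ t)) = (\<Sum>j<t. 2 ^ j :: real)"
     "(\<Sum>j<t. min (2 ^ t) (2 ^ j)) = (\<Sum>j<t. 2 ^ j :: real)"
    by (auto intro!: sum.cong simp: min_def)
  show ?case using Suc.IH by (simp add: sum.distrib m geo)
qed simp

section \<open>Slow mixing modulo Mersenne numbers\<close>

lemma prod_lessThan_add:
  fixes f :: "nat \<Rightarrow> 'a::comm_monoid_mult"
  shows "(\<Prod>i<m + n. f i) = (\<Prod>i<m. f i) * (\<Prod>i<n. f (m + i))"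
  by (induction n) (simp_all add: mult.assoc)

lemma prod_periodic:
  fixes g :: "nat \<Rightarrow> 'a::comm_monoid_mult"
  assumes g: "\<And>m. g (m + t) = g m"
  shows "(\<Prod>i<r * t. g (i + j)) = (\<Prod>i<t. g i) ^ r"
proof (induction r)
  case (Suc r)
  have "(\<Prod>i<Suc r * t. g (i + j)) = (\<Prod>i<t. g (i + j)) * (\<Prod>i<r * t. g (i + j + t))"
    by (simp add: prod_lessThan_add add_ac)
  then show ?case using Suc.IH prod.periodic_shift[of g t j, OF g] by (simp add: g)
qed simp

text \<open>As \<open>2 ^ t\<close> is congruent to 1, only exponents mod \<open>t\<close>
  matter.\<close>

lemma mersenne_dvd_power_diff:
  "int (2 ^ t - 1) dvd 2 ^ m - 2 ^ (m mod t)"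
proof -
  have "(2 ^ t - 1 :: int) dvd (2 ^ t) ^ (m div t) - 1"
    by (simp add: power_diff_1_eq)
  then have "(2 ^ t - 1 :: int) dvd ((2 ^ t) ^ (m div t) - 1) * 2 ^ (m mod t)"
    by (rule dvd_mult2)
  also have "\<dots> = 2 ^ (t * (m div t) + m mod t) - 2 ^ (m mod t)"
    by (simp only: power_add power_mult left_diff_distrib mult_1)
  finally show ?thesis by (simp add: of_nat_diff)
qed

lemma mersenne_power_frac:
  fixes p t m :: nat
  assumes t: "t \<ge> 1" and p: "p = 2 ^ t - 1"
  obtains z :: int where "2 ^ m / real p = 2 ^ (m mod t) / real p + of_int z"
proof -
  have p0: "real p > 0" using t p by (simp add: of_nat_diff)
  obtain z where z: "(2 ^ m - 2 ^ (m mod t) :: int) = int p * z"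
    using mersenne_dvd_power_diff[of t m] p by (auto elim: dvdE)
  have "real_of_int (2 ^ m - 2 ^ (m mod t)) = of_int (int p * z)" by (simp only: z)
  then have "2 ^ m / real p = 2 ^ (m mod t) / real p + of_int z"
    using p0 by (simp add: field_simps)
  then show ?thesis by (rule that)
qed

text \<open>The excluded cases are exactly the possible zeros: \<open>k = 1\<close> gives the value
  \<open>2 * b - 1\<close>, and \<open>k = 2\<close> gives real part \<open>b\<close> and imaginary
  part \<open>a - c\<close>. From \<open>k = 3\<close> on the angle is at most \<open>pi / 4\<close>
  and the real part is positive.\<close>

lemma step_char_nonzero:
  assumes abc: "a \<ge> 0" "b \<ge> 0" "c \<ge> 0" "a + b + c = 1"
    and b: "b \<noteq> 1 / 2" and ac: "\<not> (b = 0 \<and> a = 1 / 2 \<and> c = 1 / 2)"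
    and k: "k \<ge> 1"
  shows "step_char a b c (1 / 2 ^ k) \<noteq> 0"
proof -
  have Re: "Re (step_char a b c x) = b + (a + c) * cos (2 * pi * x)" for x
    by (simp add: step_char_def algebra_simps)
  have Im: "Im (step_char a b c x) = (a - c) * sin (2 * pi * x)" for x
    by (simp add: step_char_def algebra_simps)
  consider "k = 1" | "k = 2" | "k \<ge> 3" using k by linarith
  then show ?thesis
  proof cases
    assume "k = 1"
    then have "Re (step_char a b c (1 / 2 ^ k)) = b - (a + c)" by (simp add: Re)
    then show ?thesis using abc(4) b by auto
  next
    assume "k = 2"
    then have "2 * pi * (1 / 2 ^ k) = pi / 2" by simp
    then have "Re (step_char a b c (1 / 2 ^ k)) = b" "Im (step_char a b c (1 / 2 ^ k)) = a - c"
      by (simp_all only: Re Im) simp_all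
    then show ?thesis using abc(4) ac by auto
  next
    assume "k \<ge> 3"
    then have "(2::real) ^ 3 \<le> 2 ^ k" by (intro power_increasing) auto
    then have "1 / 2 ^ k \<le> 1 / (2 ^ 3 :: real)" by (intro divide_left_mono) auto
    then have "2 * pi * (1 / 2 ^ k) \<le> 2 * pi * (1 / 2 ^ 3)" by (intro mult_left_mono) auto
    also have "\<dots> < pi / 2" using pi_gt_zero by simp
    finally have "cos (2 * pi * (1 / 2 ^ k)) > 0"
      by (intro cos_gt_zero_pi) (auto intro: less_trans[of _ 0])
    moreover have "b > 0 \<or> a + c > 0" using abc by linarith
    ultimately have "Re (step_char a b c (1 / 2 ^ k)) > 0"
      unfolding Re using abc by (auto intro: add_pos_nonneg add_nonneg_pos)
    then show ?thesis by auto
  qed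
qed

text \<open>The last five factors converge to \<open>step_char a b c (1 / 2 ^ k)\<close> for \<open>k = 5, \<dots>, 1\<close>;
  the arguments of the others are summable with sum at most \<open>1 / 31\<close>, so that their product
  stays above \<open>1 - 2 * pi / 31\<close>.\<close>

lemma step_char_prod_lower_bound:
  assumes abc: "a \<ge> 0" "b \<ge> 0" "c \<ge> 0" "a + b + c = 1"
    and b: "b \<noteq> 1 / 2" and ac: "\<not> (b = 0 \<and> a = 1 / 2 \<and> c = 1 / 2)"
  obtains \<kappa> where "\<kappa> > 0" "\<forall>\<^sub>F t in sequentially. \<kappa> \<le> (\<Prod>i<t. norm (step_char a b c (2 ^ i / (2 ^ t - 1))))"
proof -
  let ?h = "\<lambda>x. norm (step_char a b c x)"
  define D where "D = ?h (1 / 2 ^ 5) * ?h (1 / 2 ^ 4) * ?h (1 / 2 ^ 3) * ?h (1 / 2 ^ 2) * ?h (1 / 2 ^ 1)"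
  have D: "D > 0"
    unfolding D_def
    by (intro mult_pos_pos zero_less_norm_iff[THEN iffD2] step_char_nonzero assms) auto
  have cont: "((\<lambda>u. ?h (x u)) \<longlongrightarrow> ?h y) sequentially" if "(x \<longlongrightarrow> y) sequentially" for x y
    unfolding step_char_def by (intro tendsto_intros that)
  have base: "(\<lambda>u::nat. 2 ^ u / (32 * 2 ^ u - 1 :: real)) \<longlonglongrightarrow> 1 / 32"
    by real_asymp
  have lim: "(\<lambda>u::nat. 2 ^ (u + m) / (2 ^ (u + 5) - 1 :: real)) \<longlonglongrightarrow> 2 ^ m * (1 / 32)" for m
    using tendsto_mult_left[OF base, of "2 ^ m"] by (simp add: power_add mult_ac)
  have lims:
    "(\<lambda>u::nat. 2 ^ u / (2 ^ (u + 5) - 1 :: real)) \<longlonglongrightarrow> 1 / 2 ^ 5"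
    "(\<lambda>u::nat. 2 ^ (u + 1) / (2 ^ (u + 5) - 1 :: real)) \<longlonglongrightarrow> 1 / 2 ^ 4"
    "(\<lambda>u::nat. 2 ^ (u + 2) / (2 ^ (u + 5) - 1 :: real)) \<longlonglongrightarrow> 1 / 2 ^ 3"
    "(\<lambda>u::nat. 2 ^ (u + 3) / (2 ^ (u + 5) - 1 :: real)) \<longlonglongrightarrow> 1 / 2 ^ 2"
    "(\<lambda>u::nat. 2 ^ (u + 4) / (2 ^ (u + 5) - 1 :: real)) \<longlonglongrightarrow> 1 / 2 ^ 1"
    using lim[of 0] lim[of 1] lim[of 2] lim[of 3] lim[of 4] by simp_all
  let ?q = "\<lambda>u::nat. 2 ^ (u + 5) - 1 :: real"
  let ?T = "\<lambda>u. ?h (2 ^ u / ?q u) * ?h (2 ^ (u + 1) / ?q u) * ?h (2 ^ (u + 2) / ?q u)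
    * ?h (2 ^ (u + 3) / ?q u) * ?h (2 ^ (u + 4) / ?q u)"
  have "(?T \<longlongrightarrow> D) sequentially"
    unfolding D_def by (intro tendsto_mult cont lims)
  then have "\<forall>\<^sub>F u in sequentially. D / 2 < ?T u"
    using D by (intro order_tendstoD) auto
  \<comment> \<open>The constant combines 1/2 from the first \<open>u\<close> factors with
    \<open>D / 2\<close> from the last five, where \<open>t = u + 5\<close>.\<close>
  then have "\<forall>\<^sub>F u in sequentially. D / 4 \<le> (\<Prod>i<u + 5. ?h (2 ^ i / ?q u))"
  proof eventually_elim
    case (elim u)
    have pow: "(1::real) \<le> 2 ^ u" by simp
    have q: "?q u \<ge> 31 * 2 ^ u" using pow by (simp add: power_add)
    have qpos: "?q u > 0" using q pow by linarith
    let ?x = "\<lambda>i. 2 * pi * (2 ^ i / ?q u)"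
    have geo: "(\<Sum>i<u. 2 ^ i :: real) = 2 ^ u - 1" by (simp add: sum_gp_strict)
    have "(\<Sum>i<u. ?x i) = 2 * pi * ((2 ^ u - 1) / ?q u)"
      unfolding geo[symmetric] sum_distrib_left sum_divide_distrib ..
    also have "\<dots> \<le> 2 * pi * (1 / 31)"
      using q qpos pow by (intro mult_left_mono) (simp_all add: field_simps)
    also have "\<dots> \<le> 1 / 2" using pi_less_4 by simp
    finally have sum: "(\<Sum>i<u. ?x i) \<le> 1 / 2" .
    have x: "?x i \<in> {0..1}" if "i \<in> {..<u}" for i
    proof -
      have nn: "?x j \<ge> 0" for j using qpos by simp
      have "?x i \<le> (\<Sum>i<u. ?x i)" using that nn by (intro member_le_sum) auto
      then have "?x i \<le> 1" using sum by linarith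
      then show ?thesis using nn[of i] by (simp only: atLeastAtMost_iff)
    qed
    \<comment> \<open>The value at 0 is 1, so the Lipschitz bound puts each factor above
      \<open>1 - ?x i\<close>, and the Weierstrass inequality reduces the product to the sum of the
      \<open>?x i\<close>.\<close>
    have "1 / 2 \<le> 1 - (\<Sum>i<u. ?x i)" using sum by simp
    also have "\<dots> \<le> (\<Prod>i<u. 1 - ?x i)" using x by (intro Weierstrass_prod_ineq) auto
    also have "\<dots> \<le> (\<Prod>i<u. ?h (2 ^ i / ?q u))"
    proof (intro prod_mono conjI)
      fix i assume i: "i \<in> {..<u}"
      show "0 \<le> 1 - ?x i" using x[OF i] by simp
      have "norm (1 - step_char a b c (2 ^ i / ?q u)) \<le> 2 * pi * \<bar>0 - 2 ^ i / ?q u\<bar>"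
        using step_char_lipschitz[OF abc, of 0 "2 ^ i / ?q u"] by (simp only: step_char_0[OF abc(4)])
      also have "\<dots> = ?x i" using qpos by simp
      finally have "norm (1 - step_char a b c (2 ^ i / ?q u)) \<le> ?x i" .
      moreover have "1 - ?h (2 ^ i / ?q u) \<le> norm (1 - step_char a b c (2 ^ i / ?q u))"
        using norm_triangle_ineq2[of 1 "step_char a b c (2 ^ i / ?q u)"] by simp
      ultimately show "1 - ?x i \<le> ?h (2 ^ i / ?q u)" by linarith
    qed
    finally have first: "1 / 2 \<le> (\<Prod>i<u. ?h (2 ^ i / ?q u))" .
    have "{..<(5::nat)} = {0, 1, 2, 3, 4}" by auto
    then have "(\<Prod>i<u + 5. ?h (2 ^ i / ?q u)) = (\<Prod>i<u. ?h (2 ^ i / ?q u)) * ?T u"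
      by (simp add: prod_lessThan_add mult.assoc)
    moreover have "1 / 2 * (D / 2) \<le> (\<Prod>i<u. ?h (2 ^ i / ?q u)) * ?T u"
      using first elim D by (intro mult_mono) auto
    ultimately show ?case by simp
  qed
  then have "\<forall>\<^sub>F t in sequentially. D / 4 \<le> (\<Prod>i<t. ?h (2 ^ i / (2 ^ t - 1)))"
    by (subst (asm) eventually_sequentially_seg)
  then show ?thesis using D by (intro that[of "D / 4"]) auto
qed

section \<open>Moments of the characters modulo a Mersenne number\<close>

context iid_increments
begin

context
  fixes p t n :: nat
  assumes abc: "a \<ge> 0" "b \<ge> 0" "c \<ge> 0" "a + b + c = 1"
    and t: "t \<ge> 2" and p: "p = 2 ^ t - 1"
begin

abbreviation (input) "chi j s \<equiv> cis (2 * pi * (2 ^ j * real_of_int s / real p))"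
abbreviation (input) "mean j \<equiv> \<Sum>s\<in>{0..<int p}. walk_prob M p B n s *\<^sub>R chi j s"
text \<open>The fractional part of \<open>2 ^ m / p\<close>, since powers of two repeat mod
  \<open>p\<close> with period \<open>t\<close>; \<open>step_char\<close> depends on this part
  only.\<close>

abbreviation (input) "frac_pow m \<equiv> 2 ^ (m mod t) / real p"

lemma mersenne_bounds: "p > 0" "real p = 2 ^ t - 1" "2 ^ t \<le> 2 * real p"
proof -
  have "(2::real) ^ 2 \<le> 2 ^ t" using t by (intro power_increasing) auto
  then show "real p = 2 ^ t - 1" "2 ^ t \<le> 2 * real p" using p by (simp_all add: of_nat_diff)
  then show "p > 0" using \<open>2 ^ 2 \<le> 2 ^ t\<close> by (cases p) auto
qed

lemma chi_mult_cnj: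
  "chi j s * cnj (chi k s) = cis (2 * pi * (of_int (2 ^ j - 2 ^ k) * of_int s / real p))"
  by (simp add: cis_cnj cis_mult algebra_simps diff_divide_distrib)

lemma step_char_frac_pow: "step_char a b c (2 ^ m / real p) = step_char a b c (frac_pow m)"
proof -
  obtain z where "2 ^ m / real p = 2 ^ (m mod t) / real p + of_int z"
    using t p by (elim mersenne_power_frac[rotated]) auto
  then show ?thesis by (simp only: step_char_int_shift)
qed

lemma mean_eq: "mean j = (\<Prod>i<n. step_char a b c (frac_pow (i + j)))"
proof -
  have "mean j = (\<Prod>i<n. step_char a b c (2 ^ i * of_int (2 ^ j) / real p))"
    using walk_fourier[OF mersenne_bounds(1) abc(4), of n "2 ^ j"] by simp
  also have "\<dots> = (\<Prod>i<n. step_char a b c (2 ^ (i + j) / real p))"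
    by (simp add: power_add)
  also have "\<dots> = (\<Prod>i<n. step_char a b c (frac_pow (i + j)))"
    by (rule prod.cong[OF refl], rule step_char_frac_pow)
  finally show ?thesis .
qed

lemma mixed_mean_eq:
  "(\<Sum>s\<in>{0..<int p}. walk_prob M p B n s *\<^sub>R (chi j s * cnj (chi k s)))
     = (\<Prod>i<n. step_char a b c (frac_pow (i + j) - frac_pow (i + k)))"
proof -
  have "step_char a b c (2 ^ i * of_int (2 ^ j - 2 ^ k) / real p)
      = step_char a b c (frac_pow (i + j) - frac_pow (i + k))" for i
  proof -
    obtain z1 where z1: "2 ^ (i + j) / real p = 2 ^ ((i + j) mod t) / real p + of_int z1"
      using t p by (elim mersenne_power_frac[rotated]) auto
    obtain z2 where z2: "2 ^ (i + k) / real p = 2 ^ ((i + k) mod t) / real p + of_int z2"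
      using t p by (elim mersenne_power_frac[rotated]) auto
    have "2 ^ i * of_int (2 ^ j - 2 ^ k) / real p = 2 ^ (i + j) / real p - 2 ^ (i + k) / real p"
      by (simp add: power_add algebra_simps diff_divide_distrib)
    also have "\<dots> = (frac_pow (i + j) - frac_pow (i + k)) + of_int (z1 - z2)"
      unfolding z1 z2 by simp
    finally show ?thesis by (simp only: step_char_int_shift)
  qed
  then show ?thesis
    unfolding chi_mult_cnj walk_fourier[OF mersenne_bounds(1) abc(4)] by simp
qed

text \<open>Both terms are products of \<open>n\<close> factors of modulus at most 1, so their
  difference is at most the sum of the factorwise differences, each of which is small if one of the
  two fractions is.\<close>

lemma covariance_bound:
  "norm ((\<Sum>s\<in>{0..<int p}. walk_prob M p B n s *\<^sub>R (chi j s * cnj (chi k s))) - mean j * cnj (mean k))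
    \<le> (\<Sum>i<n. 4 * pi * min (frac_pow (i + j)) (frac_pow (i + k)))"
proof -
  let ?h = "step_char a b c"
  have "norm ((\<Sum>s\<in>{0..<int p}. walk_prob M p B n s *\<^sub>R (chi j s * cnj (chi k s))) - mean j * cnj (mean k))
    = norm ((\<Prod>i<n. ?h (frac_pow (i + j) - frac_pow (i + k)))
        - (\<Prod>i<n. ?h (frac_pow (i + j)) * cnj (?h (frac_pow (i + k)))))"
    by (simp only: mixed_mean_eq mean_eq cnj_prod prod.distrib)
  also have "\<dots> \<le> (\<Sum>i<n. norm (?h (frac_pow (i + j) - frac_pow (i + k))
        - ?h (frac_pow (i + j)) * cnj (?h (frac_pow (i + k)))))"
    by (intro norm_prod_diff)
      (simp_all add: norm_mult norm_step_char_le_1[OF abc] mult_le_one)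
  also have "\<dots> \<le> (\<Sum>i<n. 4 * pi * min (frac_pow (i + j)) (frac_pow (i + k)))"
  proof (rule sum_mono)
    fix i
    show "norm (?h (frac_pow (i + j) - frac_pow (i + k)) - ?h (frac_pow (i + j)) * cnj (?h (frac_pow (i + k))))
      \<le> 4 * pi * min (frac_pow (i + j)) (frac_pow (i + k))"
      using step_char_diff_approx[OF abc, of "frac_pow (i + j)" "frac_pow (i + k)"] by simp
  qed
  finally show ?thesis .
qed

text \<open>At a fixed time \<open>i\<close>, the exponents \<open>i + j\<close> and
  \<open>i + k\<close> run through all residues mod \<open>t\<close>, so \<open>i\<close> drops out.
  The minima then sum to at most \<open>3 * 2 ^ t / p\<close>, hence to at most 6, and each time
  step costs \<open>4 * pi * 6\<close>.\<close>

lemma sum_covariance_bound: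
  "(\<Sum>j<t. \<Sum>k<t. norm ((\<Sum>s\<in>{0..<int p}. walk_prob M p B n s *\<^sub>R (chi j s * cnj (chi k s)))
      - mean j * cnj (mean k))) \<le> 24 * pi * real n"
proof -
  let ?m = "\<lambda>i j k. min (frac_pow (i + j)) (frac_pow (i + k))"
  have shift: "(\<Sum>j<t. \<Sum>k<t. ?m i j k) \<le> 6" for i
  proof -
    have "(\<Sum>j<t. \<Sum>k<t. ?m i j k) = (\<Sum>j<t. \<Sum>k<t. min (frac_pow (j + i)) (frac_pow k))"
    proof (rule sum.cong[OF refl])
      fix j
      have "(\<Sum>k<t. min (frac_pow (j + i)) (frac_pow (k + i)))
          = (\<Sum>k<t. min (frac_pow (j + i)) (frac_pow k))"
        by (rule sum.periodic_shift[of "\<lambda>k. min (frac_pow (j + i)) (frac_pow k)"]) simp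
      then show "(\<Sum>k<t. ?m i j k) = (\<Sum>k<t. min (frac_pow (j + i)) (frac_pow k))"
        by (simp only: add.commute[of i])
    qed
    also have "\<dots> = (\<Sum>j<t. \<Sum>k<t. min (frac_pow j) (frac_pow k))"
      by (rule sum.periodic_shift[of "\<lambda>j. \<Sum>k<t. min (frac_pow j) (frac_pow k)"]) simp
    also have "\<dots> = (\<Sum>j<t. \<Sum>k<t. min (2 ^ j) (2 ^ k)) / real p"
      unfolding sum_divide_distrib
      by (intro sum.cong refl) (auto simp: min_def divide_right_mono divide_le_cancel)
    also have "\<dots> \<le> 3 * (2 * real p) / real p"
      using sum_min_powers[of t] mersenne_bounds by (intro divide_right_mono) auto
    also have "\<dots> = 6" using mersenne_bounds(1) by simp
    finally show ?thesis .
  qed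
  have "(\<Sum>j<t. \<Sum>k<t. norm ((\<Sum>s\<in>{0..<int p}. walk_prob M p B n s *\<^sub>R (chi j s * cnj (chi k s)))
      - mean j * cnj (mean k))) \<le> (\<Sum>j<t. \<Sum>k<t. \<Sum>i<n. 4 * pi * ?m i j k)"
    by (intro sum_mono covariance_bound)
  also have "\<dots> = (\<Sum>j<t. \<Sum>i<n. \<Sum>k<t. 4 * pi * ?m i j k)"
    by (rule sum.cong[OF refl], rule sum.swap)
  also have "\<dots> = (\<Sum>i<n. \<Sum>j<t. \<Sum>k<t. 4 * pi * ?m i j k)"
    by (rule sum.swap)
  also have "\<dots> = (\<Sum>i<n. 4 * pi * (\<Sum>j<t. \<Sum>k<t. ?m i j k))"
    by (simp only: sum_distrib_left)
  also have "\<dots> \<le> (\<Sum>i<n. 4 * pi * 6)"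
    by (intro sum_mono mult_left_mono shift) simp
  also have "\<dots> = 24 * pi * real n" by simp
  finally show ?thesis .
qed

text \<open>Extending the product to \<open>r\<close> full periods can only shrink it, as the
  factors have modulus at most 1; each full period contributes at least \<open>\<kappa>\<close>,
  whatever its starting point \<open>j\<close>.\<close>

lemma norm_mean_ge:
  assumes \<kappa>: "\<kappa> > 0" "\<kappa> \<le> (\<Prod>i<t. norm (step_char a b c (2 ^ i / real p)))" and n: "n \<le> r * t"
  shows "norm (mean j) \<ge> \<kappa> ^ r"
proof -
  let ?g = "\<lambda>m. norm (step_char a b c (frac_pow m))"
  have "\<kappa> ^ r \<le> (\<Prod>i<t. ?g i) ^ r"
    using \<kappa> by (intro power_mono) auto
  also have "\<dots> = (\<Prod>i<r * t. ?g (i + j))"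
    by (rule prod_periodic[symmetric]) simp
  also have "\<dots> = (\<Prod>i<n. ?g (i + j)) * (\<Prod>i<r * t - n. ?g (n + i + j))"
    using n prod_lessThan_add[of "\<lambda>i. ?g (i + j)" n "r * t - n"] by simp
  also have "\<dots> \<le> (\<Prod>i<n. ?g (i + j)) * 1"
    by (intro mult_left_mono prod_le_1 prod_nonneg) (auto intro: norm_step_char_le_1[OF abc])
  also have "\<dots> = norm (mean j)" unfolding mean_eq by (simp add: prod_norm)
  finally show ?thesis .
qed

lemma unif_chi_mean: 
  assumes "j < t"
  shows "(\<Sum>s\<in>{0..<int p}. (1 / real p) *\<^sub>R chi j s) = 0"
proof -
  \<comment> \<open>\<open>2 * 2 ^ j \<le> p + 1\<close> suffices unless \<open>2 ^ j = 1\<close>,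
    where \<open>t \<ge> 2\<close> supplies \<open>p \<ge> 3\<close>.\<close>
  have "(2::nat) ^ j < p"
  proof -
    have "(2::nat) * 2 ^ j \<le> 2 ^ t" using assms by (simp flip: power_Suc)
    moreover have "(2::nat) ^ j \<noteq> 1 \<or> 2 ^ t \<ge> (4::nat)"
      using power_increasing[OF t, of "2::nat"] by simp
    ultimately show ?thesis using p power_increasing[OF t, of "2::nat"]
      by (cases "(2::nat) ^ j = 1") auto
  qed
  then have "\<not> p dvd 2 ^ j" by (auto dest: dvd_imp_le)
  then have "\<not> int p dvd 2 ^ j" using int_dvd_int_iff[of p "2 ^ j"] by simp
  from sum_cis_eq_0[OF mersenne_bounds(1) this] show ?thesis
    by (simp flip: scaleR_sum_right)
qed

lemma unif_chi_cov:
  assumes "j < t" "k < t"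
  shows "(\<Sum>s\<in>{0..<int p}. (1 / real p) *\<^sub>R (chi j s * cnj (chi k s))) = of_bool (j = k)"
proof (cases "j = k")
  case True
  show ?thesis unfolding chi_mult_cnj True using mersenne_bounds(1) by (simp add: scaleR_conv_of_real)
next
  case False
  have "2 * (2::int) ^ j \<le> 2 ^ t" "2 * (2::int) ^ k \<le> 2 ^ t"
    using assms by (simp_all flip: power_Suc)
  moreover have "int p = 2 ^ t - 1" using p by (simp add: of_nat_diff)
  moreover have "(2::int) ^ j \<ge> 1" "(2::int) ^ k \<ge> 1" by simp_all
  ultimately have less: "\<bar>2 ^ j - 2 ^ k :: int\<bar> < int p" by linarith
  have "(2 ^ j - 2 ^ k :: int) \<noteq> 0" using False by simp
  then have "\<not> int p dvd 2 ^ j - 2 ^ k" using dvd_imp_le_int[of "2 ^ j - 2 ^ k" "int p"] less by linarith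
  from sum_cis_eq_0[OF mersenne_bounds(1) this] False show ?thesis
    unfolding chi_mult_cnj by (simp flip: scaleR_sum_right)
qed

text \<open>The rotated characters add up to a mean of at least \<open>t * \<kappa> ^ r\<close>,
  against variances \<open>24 * pi * n\<close> and \<open>t\<close>; by \<open>n \<le> r * t\<close>
  one factor \<open>t\<close> of the squared mean cancels.\<close>

lemma unif_dist_lower_bound:
  assumes \<kappa>: "\<kappa> > 0" "\<kappa> \<le> (\<Prod>i<t. norm (step_char a b c (2 ^ i / real p)))" and n: "n \<le> r * t"
  shows "unif_dist {0..<int p} (walk_prob M p B n) \<ge> 1 - 2 * (24 * pi * real r + 1) / (real t * \<kappa> ^ (2 * r))"
proof -
  define \<alpha> where "\<alpha> j = cnj (mean j) / of_real (norm (mean j))" for j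
  have mean_pos: "norm (mean j) > 0" for j
    using norm_mean_ge[OF \<kappa> n, of j] \<kappa>(1) by (meson less_le_trans zero_less_power)
  have \<alpha>: "norm (\<alpha> j) = 1" for j
  proof -
    have "norm (\<alpha> j) = norm (mean j) / norm (mean j)"
      unfolding \<alpha>_def by (simp only: norm_divide complex_mod_cnj norm_of_real abs_norm_cancel)
    then show ?thesis using mean_pos[of j] by simp
  qed
  have \<alpha>_mean: "\<alpha> j * mean j = of_real (norm (mean j))" for j
  proof -
    have "mean j * cnj (mean j) = of_real (norm (mean j)) * of_real (norm (mean j))"
      by (simp only: complex_norm_square[symmetric] power2_eq_square of_real_mult)
    then show ?thesis using mean_pos[of j] by (simp add: \<alpha>_def field_simps)
  qed
  define m where "m = (\<Sum>j<t. \<alpha> j * mean j)"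
  have norm_m: "norm m \<ge> real t * \<kappa> ^ r"
  proof -
    have "m = of_real (\<Sum>j<t. norm (mean j))" unfolding m_def by (simp only: \<alpha>_mean of_real_sum)
    then have "norm m = (\<Sum>j<t. norm (mean j))"
      by (simp only: norm_of_real abs_of_nonneg sum_nonneg norm_ge_zero)
    moreover have "(\<Sum>j<t. \<kappa> ^ r) \<le> (\<Sum>j<t. norm (mean j))"
      by (intro sum_mono norm_mean_ge \<kappa> n)
    ultimately show ?thesis by simp
  qed
  moreover have tk: "real t * \<kappa> ^ r > 0" using t \<kappa>(1) by simp
  ultimately have m0: "m \<noteq> 0" by auto
  let ?f = "\<lambda>s. \<Sum>j<t. \<alpha> j * chi j s"
  have VP: "(\<Sum>s\<in>{0..<int p}. walk_prob M p B n s * (norm (?f s - m))\<^sup>2) \<le> 24 * pi * real n"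
    unfolding m_def
    by (rule order_trans[OF variance_le_sum_covariances[OF sum_walk_prob[OF mersenne_bounds(1) abc(4)] refl \<alpha>]
          sum_covariance_bound])
  \<comment> \<open>Under the uniform distribution the means vanish and the characters are
    orthonormal, so the double sum of covariances reduces to its diagonal.\<close>
  have VU: "(\<Sum>s\<in>{0..<int p}. 1 / real (card {0..<int p}) * (norm (?f s))\<^sup>2) \<le> real t"
  proof -
    have "(\<Sum>s\<in>{0..<int p}. 1 / real p) = 1" using mersenne_bounds(1) by simp
    from variance_le_sum_covariances[OF this, of "{..<t}" chi "\<lambda>_. 0" \<alpha>]
    have "(\<Sum>s\<in>{0..<int p}. 1 / real p * (norm (?f s))\<^sup>2)
      \<le> (\<Sum>j<t. \<Sum>k<t. norm (\<Sum>s\<in>{0..<int p}. (1 / real p) *\<^sub>R (chi j s * cnj (chi k s))))"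
      using unif_chi_mean \<alpha> by simp
    also have "\<dots> = (\<Sum>j<t. \<Sum>k<t. if j = k then 1 else 0)"
    proof (intro sum.cong refl)
      fix j k assume "j \<in> {..<t}" "k \<in> {..<t}"
      then show "norm (\<Sum>s\<in>{0..<int p}. (1 / real p) *\<^sub>R (chi j s * cnj (chi k s)))
          = (if j = k then 1 else 0)"
        by (subst unif_chi_cov) auto
    qed
    also have "\<dots> = real t" by simp
    finally show ?thesis by simp
  qed
  have "1 - 2 * (24 * pi * real n + real t) / (norm m)\<^sup>2 \<le> unif_dist {0..<int p} (walk_prob M p B n)"
    using mersenne_bounds(1) sum_walk_prob[OF mersenne_bounds(1) abc(4)]
    by (intro unif_dist_ge[OF _ _ walk_prob_nonneg _ m0 VP VU]) auto
  moreover have "2 * (24 * pi * real n + real t) / (norm m)\<^sup>2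
      \<le> 2 * (24 * pi * (real r * real t) + real t) / (real t * \<kappa> ^ r)\<^sup>2"
  proof (intro frac_le mult_left_mono add_mono)
    show "real n \<le> real r * real t" using n by (simp flip: of_nat_mult)
    show "(real t * \<kappa> ^ r)\<^sup>2 \<le> (norm m)\<^sup>2" using norm_m tk by (intro power_mono) auto
  qed (use t \<kappa>(1) in auto)
  moreover have "2 * (24 * pi * (real r * real t) + real t) / (real t * \<kappa> ^ r)\<^sup>2
      = 2 * (24 * pi * real r + 1) / (real t * \<kappa> ^ (2 * r))"
    using t \<kappa>(1) by (simp add: power_mult_distrib power2_eq_square power_mult field_simps)
  ultimately show ?thesis by linarith
qed

end

end

text \<open>For \<open>r\<close> about \<open>d * ln t\<close> the error is of order
  \<open>ln t / (t * \<kappa> ^ (2 * r))\<close>, and \<open>d\<close> is chosen so small that the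
  denominator still grows like \<open>sqrt t\<close>.\<close>

lemma no_mixing_case2:
  fixes a b c :: real
  assumes abc: "a \<ge> 0" "b \<ge> 0" "c \<ge> 0" "a + b + c = 1"
    and case2: "b \<noteq> 1 / 2" "\<not> (b = 0 \<and> a = 1 / 2 \<and> c = 1 / 2)"
  shows "\<exists>c\<^sub>2 > 0. \<forall>\<epsilon> > 0. \<exists>t\<^sub>0 :: nat. \<forall>t \<ge> t\<^sub>0. \<forall>p :: nat. p = 2 ^ t - 1 \<longrightarrow>
          (\<forall>(M :: 'w measure) B. iid_increments M B a b c \<longrightarrow>
            (\<forall>n :: nat. real n < c\<^sub>2 * ln (real p) * ln (ln (real p)) \<longrightarrow>
              unif_dist {0..<int p} (walk_prob M p B n) > 1 - \<epsilon>))"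
proof -
  obtain \<kappa>\<^sub>0 where \<kappa>0: "\<kappa>\<^sub>0 > 0"
    "\<forall>\<^sub>F t in sequentially. \<kappa>\<^sub>0 \<le> (\<Prod>i<t. norm (step_char a b c (2 ^ i / (2 ^ t - 1))))"
    using step_char_prod_lower_bound[OF abc case2] .
  \<comment> \<open>The minimum with 1/2 ensures \<open>\<kappa> < 1\<close>, so that
    \<open>L\<close> is positive.\<close>
  define \<kappa> where "\<kappa> = min \<kappa>\<^sub>0 (1 / 2)"
  have \<kappa>: "\<kappa> > 0" "\<kappa> < 1" using \<kappa>0 by (auto simp: \<kappa>_def)
  define L where "L = - ln \<kappa>"
  have L: "L > 0" using \<kappa> by (simp add: L_def)
  \<comment> \<open>Chosen so that \<open>2 * L * d = 1 / 2\<close>, which makes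
    \<open>\<kappa> powr (2 * d * ln t)\<close> equal to \<open>1 / sqrt t\<close>.\<close>
  define d where "d = 1 / (4 * L)"
  have d: "d > 0" using L by (simp add: d_def)
  \<comment> \<open>The final error bound; rounding \<open>d * ln t\<close> up to the integer
    \<open>r\<close> accounts for the inner \<open>+ 1\<close> next to \<open>ln\<close> and the
    factor \<open>exp (2 * L)\<close>.\<close>
  have "((\<lambda>t::nat. 2 * (24 * pi * (d * ln (real t) + 1) + 1) * (exp (2 * L) / sqrt (real t))) \<longlongrightarrow> 0) sequentially"
    using d by real_asymp
  note lim = order_tendstoD(2)[OF this]
  show ?thesis
  proof (intro exI[of _ d] conjI d allI impI)
    fix \<epsilon> :: real assume "\<epsilon> > 0"
    have "\<forall>\<^sub>F t in sequentially. 2 \<le> t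
        \<and> \<kappa>\<^sub>0 \<le> (\<Prod>i<t. norm (step_char a b c (2 ^ i / (2 ^ t - 1))))
        \<and> 2 * (24 * pi * (d * ln (real t) + 1) + 1) * (exp (2 * L) / sqrt (real t)) < \<epsilon>"
      by (intro eventually_conj eventually_ge_at_top \<kappa>0(2) lim[OF \<open>\<epsilon> > 0\<close>])
    then obtain t\<^sub>0 where t0: "\<And>t. t \<ge> t\<^sub>0 \<Longrightarrow> 2 \<le> t
        \<and> \<kappa>\<^sub>0 \<le> (\<Prod>i<t. norm (step_char a b c (2 ^ i / (2 ^ t - 1))))
        \<and> 2 * (24 * pi * (d * ln (real t) + 1) + 1) * (exp (2 * L) / sqrt (real t)) < \<epsilon>"
      by (auto simp: eventually_sequentially)
    have "unif_dist {0..<int p} (walk_prob M p B n) > 1 - \<epsilon>"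
      if "t \<ge> t\<^sub>0" and p: "p = 2 ^ t - 1" and "iid_increments M B a b c"
        and n: "real n < d * ln (real p) * ln (ln (real p))"
      for t p n :: nat and M :: "'w measure" and B
    proof -
      interpret iid_increments M B a b c by fact
      note t = t0[OF \<open>t \<ge> t\<^sub>0\<close>]
      have t2: "t \<ge> 2" using t by simp
      have p_real: "real p = 2 ^ t - 1" using p by (simp add: of_nat_diff)
      define r where "r = nat \<lceil>d * ln (real t)\<rceil>"
      have dln: "d * ln (real t) \<ge> 0" using d t2 by simp
      have r: "d * ln (real t) \<le> real r" "real r \<le> d * ln (real t) + 1"
        using dln unfolding r_def by linarith+
      have n_le: "n \<le> r * t"
      proof -
        have p3: "3 \<le> real p" using p_real power_increasing[OF t2, of "2::real"] by simp
        \<comment> \<open>As \<open>p\<close> exceeds e, \<open>ln (ln p)\<close> is positive, which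
          the monotonicity of the product below requires.\<close>
        have "exp 1 < (3::real)" using e_less_272 by linarith
        then have "ln (exp 1) < ln (real p)" using p3 by (subst ln_less_cancel_iff) auto
        then have ln1: "ln (real p) > 1" by simp
        have lnp: "ln (real p) \<le> real t"
        proof -
          have "ln (real p) \<le> ln (2 ^ t)" using p_real p3 by simp
          also have "\<dots> = real t * ln 2" by (simp add: ln_realpow)
          also have "\<dots> \<le> real t * 1" using ln_2_less_1 by (intro mult_left_mono) auto
          finally show ?thesis by simp
        qed
        have "real n \<le> d * (ln (real p) * ln (ln (real p)))" using n by (simp add: mult.assoc)
        also have "\<dots> \<le> d * (real t * ln (real t))"
          using ln1 lnp d t2 by (intro mult_left_mono mult_mono) auto
        also have "\<dots> = (d * ln (real t)) * real t" by simp
        also have "\<dots> \<le> real r * real t" using r by (intro mult_right_mono) auto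
        finally show ?thesis by (simp flip: of_nat_mult)
      qed
      have "\<kappa> \<le> (\<Prod>i<t. norm (step_char a b c (2 ^ i / real p)))"
        using t unfolding p_real \<kappa>_def by linarith
      from unif_dist_lower_bound[OF abc t2 p \<kappa>(1) this n_le]
      have "1 - 2 * (24 * pi * real r + 1) / (real t * \<kappa> ^ (2 * r))
          \<le> unif_dist {0..<int p} (walk_prob M p B n)" .
      moreover have "2 * (24 * pi * real r + 1) / (real t * \<kappa> ^ (2 * r)) < \<epsilon>"
      proof -
        have "exp (- (2 * L)) / sqrt (real t) = exp (- (2 * L) * (d * ln (real t) + 1))"
        proof -
          have "2 * L * d = 1 / 2" using L by (simp add: d_def)
          then have "- (2 * L) * (d * ln (real t) + 1) = - (2 * L) - 1 / 2 * ln (real t)"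
            by (metis (no_types) diff_minus_eq_add distrib_left mult.assoc mult.right_neutral mult_minus_left add.commute minus_diff_eq uminus_add_conv_diff)
          also have "exp \<dots> = exp (- (2 * L)) / sqrt (real t)"
            using t2 by (simp add: exp_diff ln_sqrt[symmetric])
          finally show ?thesis by simp
        qed
        also have "\<dots> \<le> exp (- (2 * L) * real r)"
          using r L by simp
        also have "\<dots> = \<kappa> ^ (2 * r)"
        proof -
          have "\<kappa> ^ (2 * r) = exp (real (2 * r) * ln \<kappa>)"
            using \<kappa>(1) by (simp only: exp_of_nat_mult exp_ln)
          then show ?thesis by (simp add: L_def mult_ac)
        qed
        finally have \<kappa>r: "exp (- (2 * L)) / sqrt (real t) \<le> \<kappa> ^ (2 * r)" .
        have "2 * (24 * pi * real r + 1) / (real t * \<kappa> ^ (2 * r))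
           \<le> 2 * (24 * pi * (d * ln (real t) + 1) + 1) / (real t * (exp (- (2 * L)) / sqrt (real t)))"
          using r \<kappa>r t2 dln by (intro frac_le mult_left_mono add_mono) auto
        also have "\<dots> = 2 * (24 * pi * (d * ln (real t) + 1) + 1) * (exp (2 * L) / sqrt (real t))"
        proof -
          have "1 / (real t * (exp (- (2 * L)) / sqrt (real t))) = exp (2 * L) / sqrt (real t)"
            using t2 real_sqrt_mult_self[of "real t"] by (simp add: exp_minus field_simps)
          then show ?thesis by (metis times_divide_eq_right mult.right_neutral)
        qed
        also have "\<dots> < \<epsilon>" using t by blast
        finally show ?thesis .
      qed
      ultimately show ?thesis by linarith
    qed
    then show "\<exists>t\<^sub>0 :: nat. \<forall>t \<ge> t\<^sub>0. \<forall>p :: nat. p = 2 ^ t - 1 \<longrightarrow>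
          (\<forall>(M :: 'w measure) B. iid_increments M B a b c \<longrightarrow>
            (\<forall>n :: nat. real n < d * ln (real p) * ln (ln (real p)) \<longrightarrow>
              unif_dist {0..<int p} (walk_prob M p B n) > 1 - \<epsilon>))"
      by blast
  qed
qed

theorem theorem1:
  fixes a b c :: real
  assumes "a \<ge> 0" "b \<ge> 0" "c \<ge> 0" "a + b + c = 1" "a < 1" "b < 1" "c < 1"
  shows
    "((b = 0 \<and> a = 1 / 2 \<and> c = 1 / 2) \<or> b = 1 / 2 \<longrightarrow>
        (\<forall>c\<^sub>1 > 1. \<forall>\<epsilon> > 0. \<exists>p\<^sub>0 :: nat. \<forall>p \<ge> p\<^sub>0. odd p \<longrightarrow>
          (\<forall>(M :: 'w measure) B. iid_increments M B a b c \<longrightarrow>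
            (\<forall>n :: nat. real n > c\<^sub>1 * log 2 (real p) \<longrightarrow>
              unif_dist {0..<int p} (walk_prob M p B n) < \<epsilon>))))
     \<and>
     (b \<noteq> 1 / 2 \<and> \<not> (b = 0 \<and> a = 1 / 2 \<and> c = 1 / 2) \<longrightarrow>
        (\<exists>c\<^sub>2 > 0. \<forall>\<epsilon> > 0. \<exists>t\<^sub>0 :: nat. \<forall>t \<ge> t\<^sub>0. \<forall>p :: nat. p = 2 ^ t - 1 \<longrightarrow>
          (\<forall>(M :: 'w measure) B. iid_increments M B a b c \<longrightarrow>
            (\<forall>n :: nat. real n < c\<^sub>2 * ln (real p) * ln (ln (real p)) \<longrightarrow>
              unif_dist {0..<int p} (walk_prob M p B n) > 1 - \<epsilon>))))"
  by (intro conjI impI allI mixing_case1 no_mixing_case2) (use assms in auto)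

end
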